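(* For any irreducible set $\mathscr{A}=\{A_1,\ldots,A_r\}$ of real $m\times m$ matrices ($r,m\ge 1$), any nonzero vector $e\in\mathbb{R}^m$, any initial norm $\|\cdot\|_0$ in $\mathbb{R}^m$, and any averaging function $\gamma(t,s)$, the sequences $\{\rho^{+}_n\}$ and $\{\rho^{-}_n\}$ constructed by the max-relaxation iteration procedure MR1, MR2 (described in the context) converge to the joint spectral radius $\rho(\mathscr{A})$, and the sequence of norms $\|\cdot\|_n$ converges uniformly on each bounded set to some Barabanov norm $\|\cdot\|^{*}$ of the matrix set $\mathscr{A}$. Moreover, the sequence $\{\rho^{-}_n\}$ is nondecreasing, the sequence $\{\rho^{+}_n\}$ is nonincreasing, and $$\rho^{-}_n\le\rho(\mathscr{A})\le\rho^{+}_n\qquad\text{for all } n=1,2,\ldots,$$ which provides an a posteriori estimate for the computational error of $\rho(\mathscr{A})$.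
   Context: A set $\mathscr{A}=\{A_1,\ldots,A_r\}$ of real $m\times m$ matrices is irreducible if the matrices from $\mathscr{A}$ have no common invariant subspaces except $\{0\}$ and $\mathbb{R}^m$. Its joint spectral radius is $\rho(\mathscr{A})=\limsup_{n\to\infty}\big(\max_{1\le i_1,\ldots,i_n\le r}\|A_{i_n}\cdots A_{i_1}\|\big)^{1/n}$, where $\|\cdot\|$ is the matrix norm generated by any vector norm on $\mathbb{R}^m$ (the value does not depend on the choice of norm). A Barabanov norm of $\mathscr{A}$ is a norm $\|\cdot\|$ on $\mathbb{R}^m$ such that $\rho(\mathscr{A})\|x\|=\max_i\|A_ix\|$ for all $x\in\mathbb{R}^m$. An averaging function is a continuous function $\gamma(t,s)$ defined for $t,s>0$ and satisfying $\gamma(t,t)=t$ and $\min\{t,s\}<\gamma(t,s)<\max\{t,s\}$ for $t\ne s$. Max-relaxation iteration procedure. Given an averaging function $\gamma(\cdot,\cdot)$, a norm $\|\cdot\|_0$ in $\mathbb{R}^m$ and a vector $e\in\mathbb{R}^m$ (in the description of the procedure, $e$ is taken with $\|e\|_0=1$), the norms $\|\cdot\|_n$ and $\|\cdot\|^{\circ}_n$, $n=1,2,\ldots$, are constructed recursively as follows. MR1: if the norm $\|\cdot\|_n$ has already been defined, compute $$\rho^{+}_n=\max_{x\ne0}\frac{\max_i\|A_ix\|_n}{\|x\|_n},\quad \rho^{-}_n=\min_{x\ne0}\frac{\max_i\|A_ix\|_n}{\|x\|_n},\quad \gamma_n=\gamma(\rho^-_n,\rho^+_n).$$ MR2: define the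 norms $$\|x\|_{n+1}=\max\Big\{\|x\|_n,\ \gamma_n^{-1}\max_i\|A_ix\|_n\Big\},\qquad \|x\|^{\circ}_{n+1}=\|x\|_{n+1}/\|e\|_{n+1}.$$
   Formalization: Uniform convergence to a Barabanov norm is stated for the normalized norms ‖·‖°_n = ‖·‖_n/‖e‖_n of MR2 instead of ‖·‖_n, since ‖·‖_n itself can tend to infinity (e.g. for a rotation by 90° with a suitable averaging function). *)

theory Defs
  imports "HOL-Analysis.Analysis"
begin

definition is_norm :: "(real^'m \<Rightarrow> real) \<Rightarrow> bool" where
  "is_norm N \<longleftrightarrow>
     (\<forall>x. N x \<ge> 0) \<and> (\<forall>x. N x = 0 \<longleftrightarrow> x = 0) \<and>
     (\<forall>c x. N (c *\<^sub>R x) = \<bar>c\<bar> * N x) \<and> (\<forall>x y. N (x + y) \<le> N x + N y)"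

definition irreducible_set :: "(real^'m^'m) set \<Rightarrow> bool" where
  "irreducible_set \<A> \<longleftrightarrow>
     (\<forall>V. subspace V \<and> (\<forall>A\<in>\<A>. (*v) A ` V \<subseteq> V) \<longrightarrow> V = {0} \<or> V = UNIV)"

definition products :: "(real^'m^'m) set \<Rightarrow> nat \<Rightarrow> (real^'m^'m) set" where
  "products \<A> n = {foldr (**) As (mat 1) | As. length As = n \<and> set As \<subseteq> \<A>}"

(* The value does not depend on the vector norm that generates the matrix norm; onorm is the one
   generated by the Euclidean norm. The limsup is taken in ereal because HOL's limsup needs a
   complete lattice; for a finite nonempty \<A> it is finite. *)
definition joint_spectral_radius :: "(real^'m^'m) set \<Rightarrow> real" where
  "joint_spectral_radius \<A> =
     real_of_ereal (limsup (\<lambda>n. ereal (root n (Max ((\<lambda>P. onorm ((*v) P)) ` products \<A> n)))))"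

definition max_image :: "(real^'m^'m) set \<Rightarrow> (real^'m \<Rightarrow> real) \<Rightarrow> real^'m \<Rightarrow> real" where
  "max_image \<A> N x = Max ((\<lambda>A. N (A *v x)) ` \<A>)"

definition barabanov_norm :: "(real^'m^'m) set \<Rightarrow> (real^'m \<Rightarrow> real) \<Rightarrow> bool" where
  "barabanov_norm \<A> N \<longleftrightarrow>
     is_norm N \<and> (\<forall>x. joint_spectral_radius \<A> * N x = max_image \<A> N x)"

definition averaging_function :: "(real \<Rightarrow> real \<Rightarrow> real) \<Rightarrow> bool" where
  "averaging_function \<gamma> \<longleftrightarrow>
     continuous_on ({0<..} \<times> {0<..}) (\<lambda>(t, s). \<gamma> t s) \<and>
     (\<forall>t>0. \<gamma> t t = t) \<and>
     (\<forall>t>0. \<forall>s>0. t \<noteq> s \<longrightarrow> min t s < \<gamma> t s \<and> \<gamma> t s < max t s)"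

(* For a norm N the supremum and the infimum are attained (compactness of the unit sphere). *)
definition rho_plus :: "(real^'m^'m) set \<Rightarrow> (real^'m \<Rightarrow> real) \<Rightarrow> real" where
  "rho_plus \<A> N = (SUP x\<in>{x. x \<noteq> 0}. max_image \<A> N x / N x)"

definition rho_minus :: "(real^'m^'m) set \<Rightarrow> (real^'m \<Rightarrow> real) \<Rightarrow> real" where
  "rho_minus \<A> N = (INF x\<in>{x. x \<noteq> 0}. max_image \<A> N x / N x)"

primrec mr_norm ::
  "(real^'m^'m) set \<Rightarrow> (real \<Rightarrow> real \<Rightarrow> real) \<Rightarrow> (real^'m \<Rightarrow> real) \<Rightarrow> nat \<Rightarrow> real^'m \<Rightarrow> real" where
  "mr_norm \<A> \<gamma> N\<^sub>0 0 = N\<^sub>0"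
| "mr_norm \<A> \<gamma> N\<^sub>0 (Suc n) =
     (let N = mr_norm \<A> \<gamma> N\<^sub>0 n; g = \<gamma> (rho_minus \<A> N) (rho_plus \<A> N)
      in (\<lambda>x. max (N x) (inverse g * max_image \<A> N x)))"

definition mr_rho_plus ::
  "(real^'m^'m) set \<Rightarrow> (real \<Rightarrow> real \<Rightarrow> real) \<Rightarrow> (real^'m \<Rightarrow> real) \<Rightarrow> nat \<Rightarrow> real" where
  "mr_rho_plus \<A> \<gamma> N\<^sub>0 n = rho_plus \<A> (mr_norm \<A> \<gamma> N\<^sub>0 n)"

definition mr_rho_minus ::
  "(real^'m^'m) set \<Rightarrow> (real \<Rightarrow> real \<Rightarrow> real) \<Rightarrow> (real^'m \<Rightarrow> real) \<Rightarrow> nat \<Rightarrow> real" where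
  "mr_rho_minus \<A> \<gamma> N\<^sub>0 n = rho_minus \<A> (mr_norm \<A> \<gamma> N\<^sub>0 n)"

(* The norms normalized by the vector e. It is this sequence that converges: mr_norm is
   nondecreasing in n and can tend to infinity. Take the rotation of the plane by 90 degrees,
   N\<^sub>0 x = max \<bar>x$1\<bar> (exp (-h 0) * \<bar>x$2\<bar>) with h 0 > 0, and an averaging function with
   \<gamma> t s = min t s * exp (L\<^sup>2 / (4 * (1 + L))), where L = \<bar>ln t - ln s\<bar>. The two weights then
   differ by a factor exp (h n) with 1 / h (n+1) = 1 / h n + 1 / (1 + h n), and the larger weight
   of mr_norm n is exp (h 1 + ... + h n), which is unbounded because h n \<ge> 1 / (n + 1 / h 0). *)
definition mr_norm_normalized ::
  "(real^'m^'m) set \<Rightarrow> (real \<Rightarrow> real \<Rightarrow> real) \<Rightarrow> (real^'m \<Rightarrow> real) \<Rightarrow> real^'m \<Rightarrow> nat \<Rightarrow> real^'m \<Rightarrow> real"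
  where
  "mr_norm_normalized \<A> \<gamma> N\<^sub>0 e n x = mr_norm \<A> \<gamma> N\<^sub>0 n x / mr_norm \<A> \<gamma> N\<^sub>0 n e"

end

theory Submission
  imports Defs "HOL-Complex_Analysis.Great_Picard"
begin

text \<open>
  The relaxation step preserves the inequalities \<open>r N \<le> M N \<le> R N\<close>, where \<open>M N\<close> is the maximal
  image of \<open>N\<close> under the matrix set; this makes the two sequences monotone. Irreducibility bounds
  the eccentricity (maximum over minimum on the unit sphere) of all norms with
  \<open>M N \<le> R N\<close>, so the normalized norms have a convergent subsequence, and relaxing its limit keeps both
  extremal ratios of \<open>M N / N\<close> constant. If these ratios differed, a point attaining the lower one
  would keep its initial norm in every step; by bounded eccentricity the relaxed norms would then
  increase to a norm whose upper ratio is at most the relaxation factor, a contradiction. Hence the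
  limit is a Barabanov norm. Since the eccentricity with respect to a Barabanov norm does not
  increase, the whole sequence of normalized norms converges to it.
\<close>

section \<open>Seminorms on Euclidean spaces: continuity, limits, compactness\<close>

definition is_seminorm :: "('a::real_vector \<Rightarrow> real) \<Rightarrow> bool" where
  "is_seminorm p \<longleftrightarrow> (\<forall>c x. p (c *\<^sub>R x) = \<bar>c\<bar> * p x) \<and> (\<forall>x y. p (x + y) \<le> p x + p y)"

lemma is_seminormI:
  assumes "\<And>c x. p (c *\<^sub>R x) = \<bar>c\<bar> * p x" and "\<And>x y. p (x + y) \<le> p x + p y"
  shows "is_seminorm p"
  using assms by (simp add: is_seminorm_def)

lemma is_seminorm_scaleR: "is_seminorm p \<Longrightarrow> p (c *\<^sub>R x) = \<bar>c\<bar> * p x"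
  by (simp add: is_seminorm_def)

lemma is_seminorm_triangle: "is_seminorm p \<Longrightarrow> p (x + y) \<le> p x + p y"
  by (simp add: is_seminorm_def)

lemma is_seminorm_zero: "is_seminorm p \<Longrightarrow> p 0 = 0"
  using is_seminorm_scaleR[of p 0 0] by simp

lemma is_seminorm_minus: "is_seminorm p \<Longrightarrow> p (- x) = p x"
  using is_seminorm_scaleR[of p "-1" x] by simp

lemma is_seminorm_nonneg:
  assumes "is_seminorm p" shows "0 \<le> p x"
  using is_seminorm_triangle[OF assms, of x "- x"] is_seminorm_zero[OF assms]
    is_seminorm_minus[OF assms, of x] by simp

lemma is_seminorm_abs_diff:
  assumes "is_seminorm p" shows "\<bar>p x - p y\<bar> \<le> p (x - y)"
  using is_seminorm_triangle[OF assms, of "x - y" y] is_seminorm_triangle[OF assms, of "y - x" x]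
    is_seminorm_minus[OF assms, of "x - y"] by simp

lemma is_seminorm_sum:
  assumes "is_seminorm p" "finite I"
  shows "p (\<Sum>i\<in>I. f i) \<le> (\<Sum>i\<in>I. p (f i))"
  using assms(2)
proof (induction I rule: finite_induct)
  case (insert i I)
  then show ?case
    using is_seminorm_triangle[OF assms(1), of "f i" "\<Sum>i\<in>I. f i"] by simp
qed (simp add: is_seminorm_zero[OF assms(1)])

text \<open>Expand \<open>x\<close> in the standard basis. The constant is kept explicit because,
  for a pointwise convergent sequence of seminorms, these constants converge as well.\<close>

lemma is_seminorm_le_Basis:
  fixes p :: "'a::euclidean_space \<Rightarrow> real"
  assumes "is_seminorm p"
  shows "p x \<le> (\<Sum>b\<in>Basis. p b) * norm x"
proof -
  have "p x = p (\<Sum>b\<in>Basis. (x \<bullet> b) *\<^sub>R b)"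
    by (simp add: euclidean_representation)
  also have "\<dots> \<le> (\<Sum>b\<in>Basis. p ((x \<bullet> b) *\<^sub>R b))"
    by (rule is_seminorm_sum[OF assms]) simp
  also have "\<dots> \<le> (\<Sum>b\<in>Basis. norm x * p b)"
    unfolding is_seminorm_scaleR[OF assms]
    by (intro sum_mono mult_right_mono Basis_le_norm is_seminorm_nonneg[OF assms])
  finally show ?thesis
    by (simp add: sum_distrib_left mult.commute)
qed

lemma is_seminorm_bounded:
  fixes p :: "'a::euclidean_space \<Rightarrow> real"
  assumes "is_seminorm p"
  obtains C where "C > 0" "\<And>x. p x \<le> C * norm x"
proof
  \<comment> \<open>The summand 1 keeps the constant positive even if \<open>p\<close> vanishes
    identically.\<close>
  show "(\<Sum>b\<in>Basis. p b) + 1 > 0"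
    using sum_nonneg[of Basis p] is_seminorm_nonneg[OF assms] by (simp add: add_nonneg_pos)
  show "p x \<le> ((\<Sum>b\<in>Basis. p b) + 1) * norm x" for x
    using is_seminorm_le_Basis[OF assms, of x] by (simp add: distrib_right add_increasing2)
qed

lemma is_seminorm_continuous_on:
  fixes p :: "'a::euclidean_space \<Rightarrow> real"
  assumes "is_seminorm p" shows "continuous_on S p"
proof -
  obtain C where C: "C > 0" "\<And>x. p x \<le> C * norm x"
    using is_seminorm_bounded[OF assms] by blast
  have "C-lipschitz_on UNIV p"
    using C is_seminorm_abs_diff[OF assms]
    by (intro lipschitz_onI) (auto simp: dist_norm intro: order_trans)
  then show ?thesis
    using lipschitz_on_continuous_on continuous_on_subset by blast
qed

text \<open>Homogeneity and the triangle inequality pass to pointwise limits, whereas definiteness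
  may be lost. This is why the compactness arguments work with seminorms and definiteness of a limit
  is treated separately.\<close>

lemma is_seminorm_LIMSEQ:
  assumes "\<And>j. is_seminorm (F j)" and "\<And>x. (\<lambda>j. F j x) \<longlonglongrightarrow> p x"
  shows "is_seminorm p"
proof (rule is_seminormI)
  fix c x y
  have "(\<lambda>j. \<bar>c\<bar> * F j x) \<longlonglongrightarrow> p (c *\<^sub>R x)"
    using assms(2)[of "c *\<^sub>R x"] by (simp add: is_seminorm_scaleR[OF assms(1)])
  moreover have "(\<lambda>j. \<bar>c\<bar> * F j x) \<longlonglongrightarrow> \<bar>c\<bar> * p x"
    by (intro tendsto_intros assms(2))
  ultimately show "p (c *\<^sub>R x) = \<bar>c\<bar> * p x"
    by (rule LIMSEQ_unique)
  show "p (x + y) \<le> p x + p y"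
    by (rule LIMSEQ_le[OF assms(2) tendsto_add[OF assms(2) assms(2)]])
      (simp add: is_seminorm_triangle[OF assms(1)])
qed

text \<open>In finite dimension pointwise convergence bounds the seminorms on a basis, hence makes them
  equi-Lipschitz.\<close>

lemma is_seminorm_LIMSEQ_diagonal:
  fixes F :: "nat \<Rightarrow> 'a::euclidean_space \<Rightarrow> real"
  assumes F: "\<And>j. is_seminorm (F j)" and lim: "\<And>x. (\<lambda>j. F j x) \<longlonglongrightarrow> p x"
    and z: "z \<longlonglongrightarrow> a"
  shows "(\<lambda>j. F j (z j)) \<longlonglongrightarrow> p a"
proof -
  have "(\<lambda>j. (\<Sum>b\<in>Basis. F j b) * norm (z j - a)) \<longlonglongrightarrow> (\<Sum>b\<in>Basis. p b) * norm (a - a)"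
    by (intro tendsto_intros lim z)
  then have "(\<lambda>j. (\<Sum>b\<in>Basis. F j b) * norm (z j - a)) \<longlonglongrightarrow> 0"
    by simp
  moreover have "norm (F j (z j) - F j a) \<le> (\<Sum>b\<in>Basis. F j b) * norm (z j - a)" for j
    using is_seminorm_abs_diff[OF F, of j "z j" a] is_seminorm_le_Basis[OF F, of j "z j - a"] by simp
  ultimately have "(\<lambda>j. F j (z j) - F j a) \<longlonglongrightarrow> 0"
    by (rule Lim_null_comparison[OF always_eventually[OF allI], rotated])
  from tendsto_add[OF this lim[of a]] show ?thesis
    by simp
qed

text \<open>The common bound is a common Lipschitz constant, so Arzela-Ascoli applies on the closed
  unit ball. By homogeneity, uniform convergence there becomes an error proportional to
  \<open>norm x\<close> on the whole space.\<close>

lemma is_seminorm_convergent_subsequence: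
  fixes F :: "nat \<Rightarrow> 'a::euclidean_space \<Rightarrow> real"
  assumes F: "\<And>j. is_seminorm (F j)" and C: "\<And>j x. F j x \<le> C * norm x"
  obtains k p where "strict_mono (k :: nat \<Rightarrow> nat)" "is_seminorm p"
    "\<And>x. (\<lambda>j. F (k j) x) \<longlonglongrightarrow> p x"
    "\<And>\<epsilon>. 0 < \<epsilon> \<Longrightarrow> \<forall>\<^sub>F j in sequentially. \<forall>x. \<bar>F (k j) x - p x\<bar> \<le> \<epsilon> * norm x"
proof -
  have "0 \<le> C"
  proof -
    obtain b :: 'a where "b \<in> Basis" using nonempty_Basis by blast
    then show ?thesis
      using C[of 0 b] is_seminorm_nonneg[OF F, of 0 b] by simp
  qed
  have *: "norm (F j x - F j y) \<le> C * norm (x - y)" for j x y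
    using is_seminorm_abs_diff[OF F, of j x y] C[of j "x - y"] by simp
  obtain g k where k: "strict_mono (k :: nat \<Rightarrow> nat)"
    and g: "\<And>\<epsilon>. 0 < \<epsilon> \<Longrightarrow>
      \<exists>n0. \<forall>n x. n \<ge> n0 \<and> x \<in> cball 0 1 \<longrightarrow> norm (F (k n) x - g x) < \<epsilon>"
  proof (rule Arzela_Ascoli[of "cball (0::'a) 1" F C])
    show "norm (F n x) \<le> C" if "x \<in> cball 0 1" for n x
      using C[of n x] is_seminorm_nonneg[OF F, of n x] that \<open>0 \<le> C\<close>
      by (auto intro: order_trans mult_left_le)
    show "\<exists>d. 0 < d \<and> (\<forall>n y. y \<in> cball 0 1 \<and> norm (x - y) < d \<longrightarrow> norm (F n x - F n y) < e)"
      if "0 < e" for x e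
    proof (intro exI conjI allI impI)
      \<comment> \<open>Dividing by \<open>C + 1\<close> rather than \<open>C\<close> covers the
        case \<open>C = 0\<close>.\<close>
      show "0 < e / (C + 1)" using that \<open>0 \<le> C\<close> by simp
      fix n y assume "y \<in> cball 0 1 \<and> norm (x - y) < e / (C + 1)"
      then have "(C + 1) * norm (x - y) < e"
        using \<open>0 \<le> C\<close> by (simp add: field_simps)
      then show "norm (F n x - F n y) < e"
        using *[of n x y] norm_ge_zero[of "x - y"] unfolding distrib_right by linarith
    qed
  qed auto
  \<comment> \<open>Homogeneous extension of the limit \<open>g\<close> from the unit sphere; at 0
    the factor \<open>norm x\<close> makes the value 0, whatever \<open>g 0\<close> is.\<close>
  define p where "p x = norm x * g (x /\<^sub>R norm x)" for x
  have unif: "\<forall>\<^sub>F j in sequentially. \<forall>x. \<bar>F (k j) x - p x\<bar> \<le> \<epsilon> * norm x" if "0 < \<epsilon>" for \<epsilon>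
  proof -
    obtain n0 where n0: "\<And>n x. n \<ge> n0 \<Longrightarrow> x \<in> cball 0 1 \<Longrightarrow> norm (F (k n) x - g x) < \<epsilon>"
      using g[OF \<open>0 < \<epsilon>\<close>] by blast
    have "\<bar>F (k n) x - p x\<bar> \<le> \<epsilon> * norm x" if "n \<ge> n0" for n x
    proof (cases "x = 0")
      case True
      then show ?thesis by (simp add: p_def is_seminorm_zero[OF F])
    next
      case False
      have "F (k n) x = norm x * F (k n) (x /\<^sub>R norm x)"
        using False by (simp add: is_seminorm_scaleR[OF F])
      then have "\<bar>F (k n) x - p x\<bar> = norm x * \<bar>F (k n) (x /\<^sub>R norm x) - g (x /\<^sub>R norm x)\<bar>"
        by (simp add: p_def abs_mult flip: right_diff_distrib)
      also have "\<dots> \<le> norm x * \<epsilon>"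
        using n0[OF that, of "x /\<^sub>R norm x"] False by (intro mult_left_mono) auto
      finally show ?thesis by (simp add: mult.commute)
    qed
    then show ?thesis
      by (auto simp: eventually_sequentially)
  qed
  have lim: "(\<lambda>j. F (k j) x) \<longlonglongrightarrow> p x" for x
  proof (rule tendstoI)
    fix e :: real assume "0 < e"
    have pos: "0 < norm x + 1"
      by (simp add: add_nonneg_pos)
    with \<open>0 < e\<close> have "0 < e / (norm x + 1)"
      by simp
    have "e / (norm x + 1) * norm x < e"
      using \<open>0 < e\<close> by (simp add: pos_divide_less_eq[OF pos] distrib_left)
    with unif[OF \<open>0 < e / (norm x + 1)\<close>] show "\<forall>\<^sub>F j in sequentially. dist (F (k j) x) (p x) < e"
      by (auto simp: dist_real_def elim!: eventually_mono intro: le_less_trans)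
  qed
  show thesis
    using that[OF k _ lim unif] is_seminorm_LIMSEQ[of "\<lambda>j. F (k j)", OF F lim] by blast
qed

section \<open>Norms: positivity and comparison with the Euclidean norm\<close>

lemma is_norm_imp_is_seminorm: "is_norm N \<Longrightarrow> is_seminorm N"
  by (simp add: is_norm_def is_seminorm_def)

lemma is_norm_pos: "is_norm N \<Longrightarrow> x \<noteq> 0 \<Longrightarrow> 0 < N x"
  by (metis is_norm_def order_le_less)

lemma is_norm_pos_unit:
  assumes "is_norm N" "norm x = 1" shows "0 < N x"
  using assms(2) by (intro is_norm_pos[OF assms(1)]) auto

lemma is_normI:
  assumes "is_seminorm N" and pos: "\<And>x. x \<noteq> 0 \<Longrightarrow> 0 < N x"
  shows "is_norm N"
proof -
  have "N x = 0 \<longleftrightarrow> x = 0" for x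
    using pos[of x] is_seminorm_zero[OF assms(1)] by (cases "x = 0") auto
  then show ?thesis
    using assms(1) is_seminorm_nonneg[OF assms(1)] unfolding is_norm_def is_seminorm_def by simp
qed

text \<open>The minimum of \<open>N\<close> on the compact unit sphere is attained, hence positive,
  and homogeneity extends the bound to all vectors.\<close>

lemma is_norm_lower_bound:
  fixes N :: "real^'m \<Rightarrow> real"
  assumes "is_norm N"
  obtains c where "c > 0" "\<And>x. c * norm x \<le> N x"
proof -
  obtain u where u: "u \<in> sphere (0::real^'m) 1" "\<And>x. x \<in> sphere 0 1 \<Longrightarrow> N u \<le> N x"
    using continuous_attains_inf[of "sphere (0::real^'m) 1" N]
      is_seminorm_continuous_on[OF is_norm_imp_is_seminorm[OF assms]] by auto
  show thesis
  proof
    show "N u > 0" using u(1) by (intro is_norm_pos[OF assms]) auto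
    show "N u * norm x \<le> N x" for x
    proof (cases "x = 0")
      case False
      then have "N u \<le> N (x /\<^sub>R norm x)" by (intro u) simp
      also have "\<dots> = N x / norm x"
        by (simp add: is_seminorm_scaleR[OF is_norm_imp_is_seminorm[OF assms]] divide_inverse)
      finally show ?thesis using False by (simp add: field_simps)
    qed (use is_seminorm_nonneg[OF is_norm_imp_is_seminorm[OF assms]] in simp)
  qed
qed

section \<open>The maximal image of a norm and its extremal ratios\<close>

locale finite_matrix_set =
  fixes \<A> :: "(real^'m^'m) set"
  assumes finite: "finite \<A>" and nonempty: "\<A> \<noteq> {}"
begin

abbreviation M :: "(real^'m \<Rightarrow> real) \<Rightarrow> real^'m \<Rightarrow> real" where
  "M \<equiv> max_image \<A>"

lemma max_image_ge: "A \<in> \<A> \<Longrightarrow> N (A *v x) \<le> M N x"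
  by (simp add: max_image_def finite)

lemma max_image_le_iff: "M N x \<le> r \<longleftrightarrow> (\<forall>A\<in>\<A>. N (A *v x) \<le> r)"
  by (simp add: max_image_def finite nonempty)

lemma max_image_attained: obtains A where "A \<in> \<A>" "M N x = N (A *v x)"
proof -
  have "M N x \<in> (\<lambda>A. N (A *v x)) ` \<A>"
    unfolding max_image_def by (rule Max_in) (simp_all add: finite nonempty)
  then show thesis using that by blast
qed

lemma max_image_mono: "(\<And>x. N x \<le> N' x) \<Longrightarrow> M N x \<le> M N' x"
  by (meson max_image_ge max_image_le_iff order_trans)

lemma max_image_mult_left: "0 \<le> c \<Longrightarrow> M (\<lambda>x. c * N x) x = c * M N x"
  by (metis antisym max_image_attained max_image_ge mult_left_mono)

lemma max_image_max: "M (\<lambda>x. max (f x) (g x)) x = max (M f x) (M g x)"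
proof (rule antisym)
  show "M (\<lambda>x. max (f x) (g x)) x \<le> max (M f x) (M g x)"
    unfolding max_image_le_iff by (intro ballI max.mono max_image_ge)
  show "max (M f x) (M g x) \<le> M (\<lambda>x. max (f x) (g x)) x"
    by (intro max.boundedI max_image_mono) simp_all
qed

lemma is_seminorm_max_image:
  assumes "is_seminorm N" shows "is_seminorm (M N)"
proof (rule is_seminormI)
  show "M N (c *\<^sub>R x) = \<bar>c\<bar> * M N x" for c x
    using max_image_mult_left[of "\<bar>c\<bar>" N x]
    by (simp add: max_image_def is_seminorm_scaleR[OF assms] matrix_vector_mult_scaleR)
  show "M N (x + y) \<le> M N x + M N y" for x y
  proof -
    obtain A where A: "A \<in> \<A>" "M N (x + y) = N (A *v x + A *v y)"
      using max_image_attained[of N "x + y"] by (metis matrix_vector_right_distrib)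
    then show ?thesis
      using is_seminorm_triangle[OF assms, of "A *v x" "A *v y"]
        max_image_ge[OF A(1), of N x] max_image_ge[OF A(1), of N y] by linarith
  qed
qed

lemma tendsto_max_image:
  assumes "\<And>x. ((\<lambda>j. F j x) \<longlongrightarrow> p x) G"
  shows "((\<lambda>j. M (F j) x) \<longlongrightarrow> M p x) G"
proof -
  \<comment> \<open>Stated for every finite nonempty set of matrices so that induction on the set is
    possible.\<close>
  have "((\<lambda>j. Max ((\<lambda>A. F j (A *v x)) ` \<B>)) \<longlongrightarrow> Max ((\<lambda>A. p (A *v x)) ` \<B>)) G"
    if "Finite_Set.finite \<B>" "\<B> \<noteq> {}" for \<B> :: "(real^'m^'m) set"
    using that
  proof (induction \<B> rule: finite_ne_induct)
    case (insert A \<B>)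
    then show ?case using assms by (simp add: tendsto_max)
  qed (simp add: assms)
  then show ?thesis
    using finite nonempty by (simp add: max_image_def)
qed

text \<open>The points \<open>z j\<close> move with \<open>j\<close>, but a subsequence converges on
  the compact unit sphere, and along it both sides of the equation converge by
  \<open>is_seminorm_LIMSEQ_diagonal\<close>. In this way the attainment of an extremal ratio
  survives in a limit of norms.\<close>

lemma max_image_eq_LIMSEQ:
  assumes F: "\<And>j. is_seminorm (F j)" and lim: "\<And>x. (\<lambda>j. F j x) \<longlonglongrightarrow> p x"
    and z: "\<And>j. norm (z j) = 1" and eq: "\<And>j. M (F j) (z j) = r j * F j (z j)" and r: "r \<longlonglongrightarrow> a"
  obtains x where "norm x = 1" "M p x = a * p x"
proof -
  have "\<forall>j. z j \<in> sphere 0 1" using z by simp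
  then obtain x k where x: "x \<in> sphere 0 1" and k: "strict_mono (k :: nat \<Rightarrow> nat)" and "(z \<circ> k) \<longlonglongrightarrow> x"
    using compact_sphere[THEN compact_imp_seq_compact] seq_compactE by metis
  then have zk: "(\<lambda>j. z (k j)) \<longlonglongrightarrow> x" by (simp add: o_def)
  have sub: "(\<lambda>j. f (k j)) \<longlonglongrightarrow> l" if "f \<longlonglongrightarrow> l" for f and l :: real
    using LIMSEQ_subseq_LIMSEQ[OF that k] by (simp add: o_def)
  have "(\<lambda>j. M (F (k j)) (z (k j))) \<longlonglongrightarrow> M p x"
    by (rule is_seminorm_LIMSEQ_diagonal[OF is_seminorm_max_image[OF F] tendsto_max_image zk])
      (rule sub[OF lim])
  moreover have "(\<lambda>j. r (k j) * F (k j) (z (k j))) \<longlonglongrightarrow> a * p x"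
    by (intro tendsto_mult sub[OF r] is_seminorm_LIMSEQ_diagonal[OF F sub[OF lim] zk])
  ultimately have "M p x = a * p x"
    by (simp add: eq LIMSEQ_unique)
  with x show thesis by (intro that[of x]) simp_all
qed

text \<open>The quotient of \<open>M N\<close> by \<open>N\<close> is invariant under scaling and
  continuous on the compact unit sphere, so its supremum and infimum over all nonzero vectors are
  attained there.\<close>

lemma
  assumes N: "is_norm N"
  shows rho_plus_attained: "\<exists>x. norm x = 1 \<and> M N x = rho_plus \<A> N * N x"
    and rho_minus_attained: "\<exists>x. norm x = 1 \<and> M N x = rho_minus \<A> N * N x"
    and max_image_le_rho_plus: "M N x \<le> rho_plus \<A> N * N x"
    and rho_minus_le_max_image: "rho_minus \<A> N * N x \<le> M N x"
proof -
  let ?q = "\<lambda>x. M N x / N x"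
  note sN = is_norm_imp_is_seminorm[OF N]
  have pos: "N x > 0" if "norm x = 1" for x
    using that by (intro is_norm_pos[OF N]) auto
  have cont: "continuous_on (sphere 0 1) ?q"
    by (intro continuous_on_divide is_seminorm_continuous_on is_seminorm_max_image sN)
      (use pos in \<open>force\<close>)
  have homog: "?q (x /\<^sub>R norm x) = ?q x" if "x \<noteq> 0" for x
    using that by (simp add: is_seminorm_scaleR[OF sN] is_seminorm_scaleR[OF is_seminorm_max_image[OF sN]])
  have ne: "sphere (0::real^'m) 1 \<noteq> {}" by simp
  obtain u where u: "norm u = 1" "\<And>x. norm x = 1 \<Longrightarrow> ?q x \<le> ?q u"
    using continuous_attains_sup[OF compact_sphere ne cont] by auto
  obtain v where v: "norm v = 1" "\<And>x. norm x = 1 \<Longrightarrow> ?q v \<le> ?q x"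
    using continuous_attains_inf[OF compact_sphere ne cont] by auto
  have u': "?q x \<le> ?q u" and v': "?q v \<le> ?q x" if "x \<noteq> 0" for x
    using u(2)[of "x /\<^sub>R norm x"] v(2)[of "x /\<^sub>R norm x"] homog[OF that] that by auto
  have "u \<noteq> 0" "v \<noteq> 0" using u(1) v(1) by auto
  have rp: "rho_plus \<A> N = ?q u"
    unfolding rho_plus_def by (rule cSup_eq_maximum) (use u' \<open>u \<noteq> 0\<close> in auto)
  have rm: "rho_minus \<A> N = ?q v"
    unfolding rho_minus_def by (rule cInf_eq_minimum) (use v' \<open>v \<noteq> 0\<close> in auto)
  show "\<exists>x. norm x = 1 \<and> M N x = rho_plus \<A> N * N x"
    by (rule exI[of _ u]) (use rp u(1) pos[OF u(1)] in simp)
  show "\<exists>x. norm x = 1 \<and> M N x = rho_minus \<A> N * N x"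
    by (rule exI[of _ v]) (use rm v(1) pos[OF v(1)] in simp)
  have "M N x \<le> rho_plus \<A> N * N x \<and> rho_minus \<A> N * N x \<le> M N x"
  proof (cases "x = 0")
    case True
    then show ?thesis
      by (simp add: is_seminorm_zero[OF sN] is_seminorm_zero[OF is_seminorm_max_image[OF sN]])
  next
    case False
    then show ?thesis
      using u'[OF False] v'[OF False] is_norm_pos[OF N False] by (simp add: rp rm field_simps)
  qed
  then show "M N x \<le> rho_plus \<A> N * N x" "rho_minus \<A> N * N x \<le> M N x" by auto
qed

lemma rho_plus_le:
  assumes "is_norm N" "\<And>x. M N x \<le> r * N x" shows "rho_plus \<A> N \<le> r"
proof -
  obtain x where "norm x = 1" "M N x = rho_plus \<A> N * N x"
    using rho_plus_attained[OF assms(1)] by blast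
  moreover from this have "0 < N x"
    using is_norm_pos_unit[OF assms(1)] by blast
  ultimately show ?thesis
    using assms(2)[of x] by simp
qed

lemma rho_minus_ge:
  assumes "is_norm N" "\<And>x. r * N x \<le> M N x" shows "r \<le> rho_minus \<A> N"
proof -
  obtain x where "norm x = 1" "M N x = rho_minus \<A> N * N x"
    using rho_minus_attained[OF assms(1)] by blast
  moreover from this have "0 < N x"
    using is_norm_pos_unit[OF assms(1)] by blast
  ultimately show ?thesis
    using assms(2)[of x] by simp
qed

lemma rho_minus_le_rho_plus:
  assumes "is_norm N" shows "rho_minus \<A> N \<le> rho_plus \<A> N"
proof -
  obtain x where "norm x = 1" "M N x = rho_minus \<A> N * N x"
    using rho_minus_attained[OF assms] by blast
  moreover from this have "0 < N x"
    using is_norm_pos_unit[OF assms] by blast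
  ultimately show ?thesis
    using max_image_le_rho_plus[OF assms, of x] by simp
qed

lemma rho_minus_nonneg:
  assumes "is_norm N" shows "0 \<le> rho_minus \<A> N"
  by (rule rho_minus_ge[OF assms])
    (simp add: is_seminorm_nonneg[OF is_seminorm_max_image[OF is_norm_imp_is_seminorm[OF assms]]])

end

section \<open>Matrix products and two-sided bounds for the joint spectral radius\<close>

lemma products_0: "products \<A> 0 = {mat 1}"
  by (auto simp: products_def)

lemma products_Suc: "products \<A> (Suc n) = (\<lambda>(A, P). A ** P) ` (\<A> \<times> products \<A> n)"
proof (rule equalityI)
  show "products \<A> (Suc n) \<subseteq> (\<lambda>(A, P). A ** P) ` (\<A> \<times> products \<A> n)"
  proof
    fix Q assume "Q \<in> products \<A> (Suc n)"
    then obtain A As where "Q = A ** foldr (**) As (mat 1)" "A \<in> \<A>" "length As = n" "set As \<subseteq> \<A>"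
      by (auto simp: products_def length_Suc_conv)
    then show "Q \<in> (\<lambda>(A, P). A ** P) ` (\<A> \<times> products \<A> n)"
      by (auto simp: products_def intro!: image_eqI[of _ _ "(A, foldr (**) As (mat 1))"])
  qed
  show "(\<lambda>(A, P). A ** P) ` (\<A> \<times> products \<A> n) \<subseteq> products \<A> (Suc n)"
  proof clarify
    fix A P assume "A \<in> \<A>" "P \<in> products \<A> n"
    then obtain As where "P = foldr (**) As (mat 1)" "length (A # As) = Suc n" "set (A # As) \<subseteq> \<A>"
      by (auto simp: products_def)
    then show "A ** P \<in> products \<A> (Suc n)"
      unfolding products_def by (intro CollectI exI[of _ "A # As"]) simp
  qed
qed

context finite_matrix_set
begin

lemma finite_products: "Finite_Set.finite (products \<A> n)"
  by (induction n) (simp_all add: products_0 products_Suc finite)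

lemma products_nonempty: "products \<A> n \<noteq> {}"
  by (induction n) (simp_all add: products_0 products_Suc nonempty)

lemma products_le_power:
  assumes "0 \<le> R" "\<And>x. M N x \<le> R * N x" "P \<in> products \<A> n"
  shows "N (P *v x) \<le> R ^ n * N x"
  using assms(3)
proof (induction n arbitrary: P)
  case (Suc n)
  then obtain A Q where Q: "P = A ** Q" "A \<in> \<A>" "Q \<in> products \<A> n"
    by (auto simp: products_Suc)
  have "N (P *v x) \<le> M N (Q *v x)"
    using max_image_ge[OF Q(2), of N "Q *v x"] by (simp add: Q(1) matrix_vector_mul_assoc)
  also have "\<dots> \<le> R * N (Q *v x)" by (rule assms)
  also have "\<dots> \<le> R * (R ^ n * N x)" by (intro mult_left_mono Suc.IH Q assms)
  finally show ?case by (simp add: mult.assoc)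
qed (simp add: products_0)

text \<open>Greedy choice: given a product that works for \<open>n\<close>, multiply it from the
  left by a matrix attaining the maximal image at the current vector.\<close>

lemma products_ge_power:
  assumes "0 \<le> r" "\<And>x. r * N x \<le> M N x"
  shows "\<exists>P\<in>products \<A> n. r ^ n * N x \<le> N (P *v x)"
proof (induction n)
  case (Suc n)
  then obtain Q where Q: "Q \<in> products \<A> n" "r ^ n * N x \<le> N (Q *v x)" by blast
  obtain A where A: "A \<in> \<A>" "M N (Q *v x) = N (A *v (Q *v x))"
    using max_image_attained by blast
  have "r * (r ^ n * N x) \<le> r * N (Q *v x)" by (intro mult_left_mono Q assms)
  also have "\<dots> \<le> N ((A ** Q) *v x)"
    using assms(2)[of "Q *v x"] A(2) by (simp add: matrix_vector_mul_assoc)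
  finally show ?case
    using A(1) Q(1) by (auto simp: products_Suc mult.assoc intro!: bexI[of _ "(A, Q)"])
qed (simp add: products_0)

text \<open>Comparing \<open>N\<close> with the Euclidean norm places the largest operator norm of
  products of length \<open>n\<close> between the \<open>n\<close>-th powers of the two ratios, up
  to constant positive factors. The \<open>n\<close>-th roots of these factors tend to 1.\<close>

lemma joint_spectral_radius_bounds:
  assumes N: "is_norm N"
  shows "rho_minus \<A> N \<le> joint_spectral_radius \<A>" "joint_spectral_radius \<A> \<le> rho_plus \<A> N"
proof -
  define r R where "r = rho_minus \<A> N" and "R = rho_plus \<A> N"
  have rR: "0 \<le> r" "0 \<le> R" "\<And>x. r * N x \<le> M N x" "\<And>x. M N x \<le> R * N x"
    using rho_minus_nonneg[OF N] rho_minus_le_rho_plus[OF N] max_image_le_rho_plus[OF N]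
      rho_minus_le_max_image[OF N] by (simp_all add: r_def R_def)
  obtain C where C: "C > 0" "\<And>x. N x \<le> C * norm x"
    using is_seminorm_bounded[OF is_norm_imp_is_seminorm[OF N]] by blast
  obtain c where c: "c > 0" "\<And>x. c * norm x \<le> N x"
    using is_norm_lower_bound[OF N] by blast
  define s where "s n = Max ((\<lambda>P. onorm ((*v) P)) ` products \<A> n)" for n
  have upper: "s n \<le> R ^ n * (C / c)" for n
  proof -
    have "onorm ((*v) P) \<le> R ^ n * (C / c)" if P: "P \<in> products \<A> n" for P
    proof (rule onorm_le)
      fix x
      have "c * norm (P *v x) \<le> N (P *v x)" by (rule c)
      also have "\<dots> \<le> R ^ n * N x" by (rule products_le_power[OF rR(2,4) P])
      also have "\<dots> \<le> R ^ n * (C * norm x)" by (intro mult_left_mono C) (simp add: rR)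
      finally show "norm (P *v x) \<le> R ^ n * (C / c) * norm x"
        using c(1) by (simp add: field_simps)
    qed
    then show ?thesis
      by (simp add: s_def finite_products products_nonempty)
  qed
  \<comment> \<open>A single unit vector suffices: a product that stretches it by about
    \<open>r ^ n\<close> has a correspondingly large operator norm.\<close>
  have lower: "r ^ n * (c / C) \<le> s n" for n
  proof -
    obtain u :: "real^'m" where u: "norm u = 1"
      by (meson vector_choose_size zero_le_one)
    obtain P where P: "P \<in> products \<A> n" "r ^ n * N u \<le> N (P *v u)"
      using products_ge_power[OF rR(1,3)] by blast
    have "r ^ n * c \<le> r ^ n * N u"
      using c(2)[of u] u rR(1) by (intro mult_left_mono) auto
    also have "\<dots> \<le> N (P *v u)" by (rule P)
    also have "\<dots> \<le> C * norm (P *v u)" by (rule C)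
    also have "\<dots> \<le> C * onorm ((*v) P)"
      using onorm[OF matrix_vector_mul_bounded_linear, of P u] u C(1) by simp
    also have "\<dots> \<le> C * s n"
      using C(1) P(1) by (intro mult_left_mono) (auto simp: s_def finite_products)
    finally show ?thesis using C(1) by (simp add: field_simps)
  qed
  define f where "f n = ereal (root n (s n))" for n
  have lim: "(\<lambda>n. ereal (a * root n b)) \<longlonglongrightarrow> ereal a" if "0 < b" for a b
    using tendsto_mult[OF tendsto_const[of a] LIMSEQ_root_const[OF that]] by simp
  have root_eq: "root n (a ^ n * b) = a * root n b" if "0 \<le> a" "1 \<le> n" for a b n
    unfolding real_root_mult using that by (simp add: real_root_power_cancel)
  have "ereal r \<le> limsup f"
  proof -
    have "limsup (\<lambda>n. ereal (r * root n (c / C))) \<le> limsup f"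
    proof (intro Limsup_mono eventually_sequentiallyI[of 1])
      fix n :: nat assume "1 \<le> n"
      then show "ereal (r * root n (c / C)) \<le> f n"
        unfolding f_def ereal_less_eq root_eq[OF rR(1) \<open>1 \<le> n\<close>, symmetric]
        by (intro real_root_le_mono lower) simp
    qed
    then show ?thesis
      using lim_imp_Limsup[OF trivial_limit_sequentially lim[of "c / C" r]] c(1) C(1) by simp
  qed
  moreover have "limsup f \<le> ereal R"
  proof -
    have "limsup f \<le> limsup (\<lambda>n. ereal (R * root n (C / c)))"
    proof (intro Limsup_mono eventually_sequentiallyI[of 1])
      fix n :: nat assume "1 \<le> n"
      then show "f n \<le> ereal (R * root n (C / c))"
        unfolding f_def ereal_less_eq root_eq[OF rR(2) \<open>1 \<le> n\<close>, symmetric]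
        by (intro real_root_le_mono upper) simp
    qed
    then show ?thesis
      using lim_imp_Limsup[OF trivial_limit_sequentially lim[of "C / c" R]] c(1) C(1) by simp
  qed
  \<comment> \<open>Both bounds being real, the upper limit is finite, so
    \<open>real_of_ereal\<close> returns it and not the default value 0 that it takes at
    infinity.\<close>
  ultimately obtain l where l: "limsup f = ereal l" "r \<le> l" "l \<le> R"
    by (cases "limsup f") auto
  then have "joint_spectral_radius \<A> = l"
    unfolding joint_spectral_radius_def f_def s_def by simp
  with l show "rho_minus \<A> N \<le> joint_spectral_radius \<A>" "joint_spectral_radius \<A> \<le> rho_plus \<A> N"
    by (simp_all add: r_def R_def)
qed

end

section \<open>Irreducibility and bounded eccentricity\<close>

locale irreducible_matrix_set = finite_matrix_set \<A> for \<A> :: "(real^'m^'m) set" +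
  assumes irreducible: "irreducible_set \<A>"
begin

text \<open>The kernel of \<open>p\<close> is a subspace, and
  \<open>p (A *v x) \<le> R * p x\<close> makes it invariant under every matrix of the set.
  Irreducibility leaves only the whole space once the kernel contains a nonzero vector.\<close>

lemma invariant_kernel:
  assumes p: "is_seminorm p" and R: "\<And>x. M p x \<le> R * p x"
    and "x \<noteq> 0" "p x = 0"
  shows "p y = 0"
proof -
  have "subspace {x. p x = 0}"
    unfolding subspace_def
    using is_seminorm_zero[OF p] is_seminorm_scaleR[OF p] is_seminorm_triangle[OF p] is_seminorm_nonneg[OF p]
    by (auto intro: antisym) (metis add.right_neutral antisym)
  moreover have "(*v) A ` {x. p x = 0} \<subseteq> {x. p x = 0}" if "A \<in> \<A>" for A
  proof clarify
    fix x assume "p x = 0"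
    then have "p (A *v x) \<le> 0"
      using max_image_ge[OF that, of p x] R[of x] by simp
    then show "p (A *v x) = 0" using is_seminorm_nonneg[OF p, of "A *v x"] by simp
  qed
  ultimately have "{x. p x = 0} = {0} \<or> {x. p x = 0} = UNIV"
    using irreducible unfolding irreducible_set_def by blast
  with assms(3,4) show ?thesis by blast
qed

text \<open>The constant depends on \<open>R\<close> and the matrix set but not on the norm.
  Otherwise there are norms of eccentricity tending to infinity; scaled to maximum 1 on the unit
  sphere, they have a subsequence converging to a seminorm that satisfies the same bound with
  \<open>R\<close>, vanishes at some unit vector and takes the value 1 at another. This contradicts
  \<open>invariant_kernel\<close>.\<close>

lemma bounded_eccentricity:
  obtains C where "C > 0"
    "\<And>N x y. is_norm N \<Longrightarrow> (\<And>z. M N z \<le> R * N z) \<Longrightarrow> norm x = 1 \<Longrightarrow> norm y = 1 \<Longrightarrow> N y \<le> C * N x"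
proof (rule ccontr)
  assume neg: "\<not> thesis"
  have "\<exists>N x y. is_norm N \<and> (\<forall>z. M N z \<le> R * N z) \<and> norm x = 1 \<and> norm y = 1 \<and> real (Suc j) * N x < N y"
    for j
  proof (rule ccontr)
    assume "\<not> ?thesis"
    then have "thesis" by (intro that[of "real (Suc j)"]) (auto simp: not_less)
    with neg show False by blast
  qed
  then obtain N x y where N: "\<And>j. is_norm (N j)" and NR: "\<And>j z. M (N j) z \<le> R * N j z"
    and x: "\<And>j. norm (x j) = 1" and y: "\<And>j. norm (y j) = 1"
    and xy: "\<And>j. real (Suc j) * N j (x j) < N j (y j)"
    by metis
  note sN = is_norm_imp_is_seminorm[OF N]
  have "\<exists>w. norm w = 1 \<and> (\<forall>v. norm v = 1 \<longrightarrow> N j v \<le> N j w)" for j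
    using continuous_attains_sup[of "sphere (0::real^'m) 1" "N j"] is_seminorm_continuous_on[OF sN]
    by auto
  then obtain w where w: "\<And>j. norm (w j) = 1" and w_max: "\<And>j v. norm v = 1 \<Longrightarrow> N j v \<le> N j (w j)"
    by metis
  have pos: "0 < N j (w j)" for j by (rule is_norm_pos_unit[OF N w])
  \<comment> \<open>Scaling by the maximum of \<open>N j\<close> on the unit sphere, attained at
    \<open>w j\<close>.\<close>
  define F where "F j v = inverse (N j (w j)) * N j v" for j v
  have inv: "0 \<le> inverse (N j (w j))" for j using pos[of j] by simp
  have F: "is_seminorm (F j)" for j
  proof (rule is_seminormI)
    show "F j (a + b) \<le> F j a + F j b" for a b
      using mult_left_mono[OF is_seminorm_triangle[OF sN[of j]] inv[of j], of a b] by (simp add: F_def distrib_left)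
  qed (simp add: F_def is_seminorm_scaleR[OF sN])
  have F_le: "F j v \<le> 1 * norm v" for j v
  proof (cases "v = 0")
    case False
    then have "N j (v /\<^sub>R norm v) \<le> N j (w j)" by (intro w_max) simp
    then show ?thesis using False pos[of j]
      by (simp add: F_def is_seminorm_scaleR[OF sN] field_simps)
  qed (simp add: is_seminorm_zero[OF F])
  obtain k p where k: "strict_mono (k :: nat \<Rightarrow> nat)" and p: "is_seminorm p"
    and lim: "\<And>x. (\<lambda>j. F (k j) x) \<longlonglongrightarrow> p x"
    using is_seminorm_convergent_subsequence[of F 1, OF F F_le] by metis
  have F_one: "F j (w j) = 1" for j using pos[of j] by (simp add: F_def)
  have F_small: "F j (x j) \<le> inverse (real (Suc j))" for j
  proof -
    have "real (Suc j) * N j (x j) < N j (w j)"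
      using xy[of j] w_max[OF y, of j j] by simp
    then show ?thesis using pos[of j] by (simp add: F_def field_simps del: of_nat_Suc)
  qed
  have "M p v \<le> R * p v" for v
  proof (rule LIMSEQ_le)
    show "(\<lambda>j. M (F (k j)) v) \<longlonglongrightarrow> M p v" by (rule tendsto_max_image[OF lim])
    show "(\<lambda>j. R * F (k j) v) \<longlonglongrightarrow> R * p v" by (intro tendsto_intros lim)
    have "M (F j) v \<le> R * F j v" for j
    proof -
      have "M (F j) v = inverse (N j (w j)) * M (N j) v"
        unfolding F_def by (rule max_image_mult_left[OF inv])
      also have "\<dots> \<le> inverse (N j (w j)) * (R * N j v)" by (rule mult_left_mono[OF NR inv])
      finally show ?thesis by (simp add: F_def mult_ac)
    qed
    then show "\<exists>n0. \<forall>n\<ge>n0. M (F (k n)) v \<le> R * F (k n) v" by blast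
  qed
  \<comment> \<open>A limit point of the vectors \<open>x j\<close>, at which the scaled norms tend
    to 0.\<close>
  moreover have "\<exists>a. norm a = 1 \<and> p a = 0"
  proof -
    have "\<forall>j. x (k j) \<in> sphere 0 1" using x by simp
    then obtain a l where a: "a \<in> sphere 0 1" and l: "strict_mono (l :: nat \<Rightarrow> nat)"
      and "((\<lambda>j. x (k j)) \<circ> l) \<longlonglongrightarrow> a"
      using compact_sphere[THEN compact_imp_seq_compact] seq_compactE by metis
    then have al: "(\<lambda>j. x (k (l j))) \<longlonglongrightarrow> a" by (simp add: o_def)
    have lim': "(\<lambda>j. F (k (l j)) v) \<longlonglongrightarrow> p v" for v
      using LIMSEQ_subseq_LIMSEQ[OF lim l, of v] by (simp add: o_def)
    have "(\<lambda>j. F (k (l j)) (x (k (l j)))) \<longlonglongrightarrow> p a"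
      by (rule is_seminorm_LIMSEQ_diagonal[OF F lim' al])
    moreover have "(\<lambda>j. F (k (l j)) (x (k (l j)))) \<longlonglongrightarrow> 0"
    proof (rule tendsto_sandwich[OF _ _ tendsto_const LIMSEQ_inverse_real_of_nat])
      show "\<forall>\<^sub>F j in sequentially. 0 \<le> F (k (l j)) (x (k (l j)))"
        by (simp add: is_seminorm_nonneg[OF F])
      have "F (k (l j)) (x (k (l j))) \<le> inverse (real (Suc j))" for j
      proof -
        have "j \<le> k (l j)" using seq_suble[OF k] seq_suble[OF l] order_trans by metis
        then have "inverse (real (Suc (k (l j)))) \<le> inverse (real (Suc j))" by simp
        then show ?thesis using F_small[of "k (l j)"] by linarith
      qed
      then show "\<forall>\<^sub>F j in sequentially. F (k (l j)) (x (k (l j))) \<le> inverse (real (Suc j))"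
        by simp
    qed
    ultimately have "p a = 0" by (rule LIMSEQ_unique)
    with a show ?thesis by auto
  qed
  \<comment> \<open>A limit point of the maximizers \<open>w j\<close>; it shows that the limit
    seminorm is not identically zero.\<close>
  moreover have "\<exists>b. p b = 1"
  proof -
    have "\<forall>j. w (k j) \<in> sphere 0 1" using w by simp
    then obtain b l where l: "strict_mono (l :: nat \<Rightarrow> nat)" and "((\<lambda>j. w (k j)) \<circ> l) \<longlonglongrightarrow> b"
      using compact_sphere[THEN compact_imp_seq_compact] seq_compactE by metis
    then have bl: "(\<lambda>j. w (k (l j))) \<longlonglongrightarrow> b" by (simp add: o_def)
    have lim': "(\<lambda>j. F (k (l j)) v) \<longlonglongrightarrow> p v" for v
      using LIMSEQ_subseq_LIMSEQ[OF lim l, of v] by (simp add: o_def)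
    have "(\<lambda>j. F (k (l j)) (w (k (l j)))) \<longlonglongrightarrow> p b"
      by (rule is_seminorm_LIMSEQ_diagonal[OF F lim' bl])
    then have "p b = 1" unfolding F_one by (simp add: LIMSEQ_const_iff)
    then show ?thesis by blast
  qed
  ultimately show False
    using invariant_kernel[OF p, of R] by (metis norm_zero zero_neq_one)
qed

end

section \<open>One relaxation step and the inequalities it preserves\<close>

lemma is_norm_divide: "is_norm N \<Longrightarrow> 0 < c \<Longrightarrow> is_norm (\<lambda>x. N x / c)"
  by (simp add: is_norm_def divide_right_mono flip: add_divide_distrib)

context finite_matrix_set
begin

lemma max_image_divide: "0 < c \<Longrightarrow> M (\<lambda>x. N x / c) x = M N x / c"
  using max_image_mult_left[of "inverse c" N x] by (simp add: divide_inverse_commute)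

lemma is_norm_relax:
  assumes N: "is_norm N" and c: "0 \<le> c"
  shows "is_norm (\<lambda>x. max (N x) (c * M N x))"
proof (rule is_normI)
  note sN = is_norm_imp_is_seminorm[OF N] note sM = is_seminorm_max_image[OF sN]
  show "is_seminorm (\<lambda>x. max (N x) (c * M N x))"
  proof (rule is_seminormI)
    show "max (N (b *\<^sub>R x)) (c * M N (b *\<^sub>R x)) = \<bar>b\<bar> * max (N x) (c * M N x)" for b x
      by (simp add: is_seminorm_scaleR[OF sN] is_seminorm_scaleR[OF sM] max_mult_distrib_left mult_ac)
    show "max (N (x + y)) (c * M N (x + y)) \<le> max (N x) (c * M N x) + max (N y) (c * M N y)" for x y
      using is_seminorm_triangle[OF sN, of x y]
        mult_left_mono[OF is_seminorm_triangle[OF sM, of x y] c]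
      unfolding distrib_left by linarith
  qed
  show "0 < max (N x) (c * M N x)" if "x \<noteq> 0" for x
    using is_norm_pos[OF N that] by simp
qed

lemma max_image_max_image_le:
  assumes "0 \<le> r" "\<And>x. M N x \<le> r * N x" shows "M (M N) x \<le> r * M N x"
  using max_image_mono[of "M N" "\<lambda>x. r * N x"] assms by (simp add: max_image_mult_left)

lemma max_image_max_image_ge:
  assumes "0 \<le> r" "\<And>x. r * N x \<le> M N x" shows "r * M N x \<le> M (M N) x"
  using max_image_mono[of "\<lambda>x. r * N x" "M N"] assms by (simp add: max_image_mult_left)

lemma max_image_relax:
  "0 \<le> c \<Longrightarrow> M (\<lambda>x. max (N x) (c * M N x)) x = max (M N x) (c * M (M N) x)"
  by (simp add: max_image_max max_image_mult_left)

text \<open>The operator \<open>M\<close> commutes with maxima and nonnegative factors, so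
  relaxation replaces the pair \<open>N\<close>, \<open>M N\<close> by \<open>M N\<close>,
  \<open>M (M N)\<close>, and the bound holds for each member of the pair. The lower bound in
  \<open>max_image_relax_ge\<close> is preserved in the same way.\<close>

lemma max_image_relax_le:
  assumes "0 \<le> r" "0 \<le> c" "\<And>x. M N x \<le> r * N x"
  shows "M (\<lambda>x. max (N x) (c * M N x)) x \<le> r * max (N x) (c * M N x)"
  using assms(3)[of x] mult_left_mono[OF max_image_max_image_le[OF assms(1,3)] assms(2), of x]
    max_mult_distrib_left[of r "N x" "c * M N x"] assms(1)
  by (auto simp: max_image_relax[OF assms(2)] mult_ac le_max_iff_disj)

lemma max_image_relax_ge:
  assumes "0 \<le> r" "0 \<le> c" "\<And>x. r * N x \<le> M N x"
  shows "r * max (N x) (c * M N x) \<le> M (\<lambda>x. max (N x) (c * M N x)) x"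
  using assms(3)[of x] mult_left_mono[OF max_image_max_image_ge[OF assms(1,3)] assms(2), of x]
    max_mult_distrib_left[of r "N x" "c * M N x"] assms(1)
  by (auto simp: max_image_relax[OF assms(2)] mult_ac le_max_iff_disj)

text \<open>The eccentricity of a norm with respect to a Barabanov norm does not increase under
  relaxation.\<close>

lemma relax_eccentricity:
  assumes N: "is_norm N" and p: "is_norm p" and eq: "\<And>x. M p x = \<rho> * p x" and "0 < \<rho>" and "0 \<le> c" "0 \<le> q"
    and le: "\<And>x y. N x * p y \<le> q * (N y * p x)"
  shows "max (N x) (c * M N x) * p y \<le> q * (max (N y) (c * M N y) * p x)"
proof -
  note sM = is_seminorm_max_image[OF is_norm_imp_is_seminorm[OF N]]
  have p0: "0 \<le> p z" for z by (rule is_seminorm_nonneg[OF is_norm_imp_is_seminorm[OF p]])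
  have "q * (N y * p x) \<le> q * (max (N y) (c * M N y) * p x)"
    by (intro mult_left_mono mult_right_mono p0 assms) simp
  with le[of x y] have 1: "N x * p y \<le> q * (max (N y) (c * M N y) * p x)" by linarith
  have 2: "c * M N x * p y \<le> q * (max (N y) (c * M N y) * p x)"
  proof -
    \<comment> \<open>The hypothesis on \<open>q\<close> is applied to the images
      \<open>A *v x\<close> and \<open>B *v y\<close>: \<open>A\<close> attains \<open>M N\<close>
      at \<open>x\<close>, and \<open>B\<close> attains \<open>M p\<close> at \<open>y\<close>.
      Since \<open>M p\<close> is exactly \<open>\<rho> * p\<close>, a factor \<open>\<rho>\<close>
      appears on both sides and cancels.\<close>
    obtain A where A: "A \<in> \<A>" "M N x = N (A *v x)" by (rule max_image_attained)
    obtain B where B: "B \<in> \<A>" "M p y = p (B *v y)" by (rule max_image_attained)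
    have "\<rho> * (M N x * p y) = N (A *v x) * p (B *v y)"
      using eq[of y] A B by simp
    also have "\<dots> \<le> q * (N (B *v y) * p (A *v x))" by (rule le)
    also have "\<dots> \<le> q * (M N y * p (A *v x))"
      by (intro mult_left_mono mult_right_mono p0 assms max_image_ge B)
    also have "\<dots> \<le> q * (M N y * (\<rho> * p x))"
      using max_image_ge[OF A(1), of p x] eq[of x] is_seminorm_nonneg[OF sM, of y]
      by (intro mult_left_mono assms) auto
    finally have "M N x * p y \<le> q * (M N y * p x)" using \<open>0 < \<rho>\<close> by simp
    then have "c * (M N x * p y) \<le> c * (q * (M N y * p x))" by (rule mult_left_mono[OF _ \<open>0 \<le> c\<close>])
    also have "\<dots> = q * ((c * M N y) * p x)" by simp
    also have "\<dots> \<le> q * (max (N y) (c * M N y) * p x)"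
      by (intro mult_left_mono mult_right_mono p0 assms) simp
    finally show ?thesis by simp
  qed
  show ?thesis using 1 2 by (auto simp: max_def)
qed

end

section \<open>Relaxation under irreducibility\<close>

context irreducible_matrix_set
begin

text \<open>The seminorm \<open>M N\<close> vanishes at the unit vector attaining the lower ratio
  and inherits the upper bound of \<open>N\<close>, so \<open>invariant_kernel\<close> applies to
  it. This settles the degenerate case, in which the averaging function would be evaluated outside
  its domain.\<close>

lemma max_image_eq_zero:
  assumes N: "is_norm N" and "rho_minus \<A> N = 0" shows "M N x = 0"
proof -
  obtain u where u: "norm u = 1" "M N u = 0"
    using rho_minus_attained[OF N] assms(2) by auto
  then have "u \<noteq> 0" by auto
  have "0 \<le> rho_plus \<A> N"
    using rho_minus_le_rho_plus[OF N] assms(2) by simp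
  from max_image_max_image_le[OF this max_image_le_rho_plus[OF N]] show ?thesis
    by (rule invariant_kernel[OF is_seminorm_max_image[OF is_norm_imp_is_seminorm[OF N]] _ \<open>u \<noteq> 0\<close> u(2)])
qed

text \<open>Scaling removes the restriction to unit vectors, as needed for comparison with an
  arbitrary nonzero \<open>e\<close>.\<close>

lemma bounded_eccentricity_homogeneous:
  obtains C where "C > 0"
    "\<And>N x y. is_norm N \<Longrightarrow> (\<And>z. M N z \<le> R * N z) \<Longrightarrow> N y * norm x \<le> C * (N x * norm y)"
proof -
  obtain C where C: "C > 0"
    "\<And>N x y. is_norm N \<Longrightarrow> (\<And>z. M N z \<le> R * N z) \<Longrightarrow> norm x = 1 \<Longrightarrow> norm y = 1 \<Longrightarrow> N y \<le> C * N x"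
    using bounded_eccentricity[of R] by blast
  show thesis
  proof (rule that[OF C(1)])
    fix N x y assume N: "is_norm N" "\<And>z. M N z \<le> R * N z"
    note sN = is_norm_imp_is_seminorm[OF N(1)]
    show "N y * norm x \<le> C * (N x * norm y)"
    proof (cases "x = 0 \<or> y = 0")
      case False
      then have "N (y /\<^sub>R norm y) \<le> C * N (x /\<^sub>R norm x)"
        by (intro C(2) N) auto
      then show ?thesis
        using False by (simp add: is_seminorm_scaleR[OF sN] field_simps)
    qed (auto simp: is_seminorm_zero[OF sN])
  qed
qed

text \<open>At a point where the lower ratio is attained the relaxed norms do not grow, so by bounded
  eccentricity they are bounded and increase to a norm whose upper ratio is at most \<open>g\<close>.\<close>

lemma relaxation_not_stationary:
  assumes norm: "\<And>k. is_norm (S k)"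
    and Suc: "\<And>k x. S (Suc k) x = max (S k x) (inverse g * M (S k) x)"
    and g: "0 < g" "r < g" "g < R"
    and upper: "\<And>k x. M (S k) x \<le> R * S k x"
    and r_attained: "\<And>k. \<exists>x. norm x = 1 \<and> M (S k) x = r * S k x"
    and R_attained: "\<And>k. \<exists>x. norm x = 1 \<and> M (S k) x = R * S k x"
  shows False
proof -
  note sS = is_norm_imp_is_seminorm[OF norm]
  have mono_Suc: "S k x \<le> S (Suc k) x" for k x by (simp add: Suc)
  have inc: "incseq (\<lambda>k. S k x)" for x by (rule incseq_SucI) (rule mono_Suc)
  have le_Suc: "M (S k) x \<le> g * S (Suc k) x" for k x
  proof -
    have "inverse g * M (S k) x \<le> S (Suc k) x" by (simp add: Suc)
    then show ?thesis using g(1) by (simp add: field_simps)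
  qed
  \<comment> \<open>Unrolling the recursion, \<open>S k x\<close> is the maximum of its initial
    value and of the terms \<open>inverse g * M (S j) x\<close> with \<open>j < k\<close>; these
    terms grow with \<open>j\<close>, so the current one dominates them.\<close>
  have le: "S k x \<le> max (S 0 x) (inverse g * M (S k) x)" for k x
  proof (induction k)
    case (Suc k)
    have "inverse g * M (S k) x \<le> inverse g * M (S (Suc k)) x"
      using g(1) mono_Suc by (intro mult_left_mono max_image_mono) auto
    with Suc show ?case unfolding assms(2)[of k x] by linarith
  qed simp
  \<comment> \<open>Since \<open>r < g\<close>, the second term of the maximum in \<open>le\<close>
    is strictly below \<open>S k x\<close>, so the initial value prevails. The comparison goes back
    to stage 0 directly because the attaining point may differ from stage to stage.\<close>
  have low: "S k x = S 0 x" if "norm x = 1" "M (S k) x = r * S k x" for k x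
  proof (rule antisym)
    have "inverse g * M (S k) x < S k x"
      using is_norm_pos_unit[OF norm that(1), of k] g(1,2) by (simp add: that(2) field_simps)
    with le[of k x] show "S k x \<le> S 0 x" by linarith
    show "S 0 x \<le> S k x" using incseqD[OF inc[of x], of 0 k] by simp
  qed
  obtain C where C: "C > 0"
    "\<And>N x y. is_norm N \<Longrightarrow> (\<And>z. M N z \<le> R * N z) \<Longrightarrow> N y * norm x \<le> C * (N x * norm y)"
    using bounded_eccentricity_homogeneous[of R] by blast
  obtain D where D: "D > 0" "\<And>x. S 0 x \<le> D * norm x"
    using is_seminorm_bounded[OF sS[of 0]] by blast
  have bound: "S k y \<le> C * (D * norm y)" for k y
  proof -
    obtain x where x: "norm x = 1" "M (S k) x = r * S k x" using r_attained by blast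
    have "S k y \<le> C * (S 0 x * norm y)"
      using C(2)[OF norm[of k] upper, where x = x and y = y] x low[OF x] by simp
    also have "\<dots> \<le> C * (D * norm y)"
      using D(2)[of x] x C(1) by (intro mult_left_mono mult_right_mono) auto
    finally show ?thesis .
  qed
  have "\<exists>l. (\<lambda>k. S k x) \<longlonglongrightarrow> l" for x
    by (rule incseq_convergent[OF inc[of x], of "C * (D * norm x)"]) (use bound in blast)+
  then obtain T where T: "\<And>x. (\<lambda>k. S k x) \<longlonglongrightarrow> T x" by metis
  have "M T x \<le> g * T x" for x
    by (rule LIMSEQ_le[OF tendsto_max_image[OF T] tendsto_mult[OF tendsto_const LIMSEQ_Suc[OF T]]])
      (use le_Suc in blast)
  \<comment> \<open>The upper ratio \<open>R\<close> is attained at every stage, hence also by the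
    limit \<open>T\<close>, whose ratios are at most \<open>g < R\<close>.\<close>
  moreover obtain z where "\<And>k. norm (z k) = 1" "\<And>k. M (S k) (z k) = R * S k (z k)"
    using R_attained by metis
  then obtain x where x: "norm x = 1" "M T x = R * T x"
    using max_image_eq_LIMSEQ[of S T z "\<lambda>_. R" R, OF sS T] by auto
  moreover have "0 < T x"
    using is_norm_pos_unit[OF norm x(1), of 0] incseq_le[OF inc[of x] T[of x], of 0] by linarith
  ultimately show False
    using g(3) by (metis mult_le_cancel_right_pos not_le)
qed

end

section \<open>Averaging functions and the convergence of the iteration\<close>

lemma averaging_function_between:
  assumes "averaging_function \<gamma>" "0 < t" "t \<le> s"
  shows "t \<le> \<gamma> t s" "\<gamma> t s \<le> s" "t < s \<Longrightarrow> t < \<gamma> t s" "t < s \<Longrightarrow> \<gamma> t s < s"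
proof -
  have "t < \<gamma> t s \<and> \<gamma> t s < s" if "t < s"
  proof -
    have "\<forall>t>0. \<forall>s>0. t \<noteq> s \<longrightarrow> min t s < \<gamma> t s \<and> \<gamma> t s < max t s"
      using assms(1) unfolding averaging_function_def by blast
    moreover have "0 < s" "t \<noteq> s" using assms(2) that by auto
    ultimately have "min t s < \<gamma> t s \<and> \<gamma> t s < max t s" using assms(2) by blast
    with that show ?thesis by simp
  qed
  moreover have "\<gamma> t s = t" if "t = s"
    using assms that unfolding averaging_function_def by simp
  ultimately show "t \<le> \<gamma> t s" "\<gamma> t s \<le> s" "t < s \<Longrightarrow> t < \<gamma> t s" "t < s \<Longrightarrow> \<gamma> t s < s"
    using assms(3) by (cases "t = s"; fastforce)+
qed

lemma averaging_function_tendsto: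
  assumes "averaging_function \<gamma>" "f \<longlonglongrightarrow> a" "h \<longlonglongrightarrow> b" "0 < a" "0 < b"
    "\<And>n. 0 < f n" "\<And>n. 0 < h n"
  shows "(\<lambda>n. \<gamma> (f n) (h n)) \<longlonglongrightarrow> \<gamma> a b"
proof -
  have "continuous_on ({0<..} \<times> {0<..}) (\<lambda>(t, s). \<gamma> t s)"
    using assms(1) by (simp add: averaging_function_def)
  from continuous_on_tendsto_compose[OF this tendsto_Pair[OF assms(2,3)]] show ?thesis
    using assms(4-7) by simp
qed

text \<open>Averaging functions are constrained at positive arguments only. Positivity of the
  initial lower ratio is therefore assumed here and persists through the iteration.\<close>

locale max_relaxation = irreducible_matrix_set \<A> for \<A> :: "(real^'m^'m) set" +
  fixes \<gamma> :: "real \<Rightarrow> real \<Rightarrow> real" and N\<^sub>0 :: "real^'m \<Rightarrow> real"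
  assumes averaging: "averaging_function \<gamma>" and norm_0: "is_norm N\<^sub>0"
    and rho_minus_0: "0 < rho_minus \<A> N\<^sub>0"
begin

abbreviation "N \<equiv> mr_norm \<A> \<gamma> N\<^sub>0"
abbreviation "rm \<equiv> mr_rho_minus \<A> \<gamma> N\<^sub>0"
abbreviation "rp \<equiv> mr_rho_plus \<A> \<gamma> N\<^sub>0"
abbreviation "g n \<equiv> \<gamma> (rm n) (rp n)"

lemma mr_norm_Suc: "N (Suc n) = (\<lambda>x. max (N n x) (inverse (g n) * M (N n) x))"
  by (simp add: Let_def mr_rho_minus_def mr_rho_plus_def)

declare mr_norm.simps(2) [simp del]

lemma
  assumes "is_norm (N n)"
  shows max_image_le_mr: "M (N n) x \<le> rp n * N n x"
    and mr_le_max_image: "rm n * N n x \<le> M (N n) x"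
    and mr_minus_le_plus: "rm n \<le> rp n"
  using assms by (simp_all add: mr_rho_minus_def mr_rho_plus_def max_image_le_rho_plus
      rho_minus_le_max_image rho_minus_le_rho_plus)

text \<open>Both claims rest on one step: if \<open>N n\<close> is a norm with positive lower ratio,
  then the factor \<open>g n\<close> is positive, relaxation gives a norm, and the ratios move
  monotonically. Monotonicity in turn keeps the lower ratio positive, which closes the
  induction.\<close>

lemma mr_norm_and_rho_pos: "is_norm (N n) \<and> 0 < rm n"
  and mr_rho_step: "rm n \<le> rm (Suc n) \<and> rp (Suc n) \<le> rp n"
proof -
  have step': "is_norm (N (Suc n)) \<and> rm n \<le> rm (Suc n) \<and> rp (Suc n) \<le> rp n"
    if "is_norm (N n) \<and> 0 < rm n" for n
  proof -
    from that have n: "is_norm (N n)" "0 < rm n" by auto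
    have "rm n \<le> g n"
      using averaging_function_between(1)[OF averaging n(2) mr_minus_le_plus[OF n(1)]] .
    with n have c: "0 \<le> inverse (g n)" by simp
    have Suc: "is_norm (N (Suc n))"
      unfolding mr_norm_Suc by (rule is_norm_relax[OF n(1) c])
    moreover have "rm n \<le> rm (Suc n)"
      unfolding mr_rho_minus_def[of _ _ _ "Suc n"]
    proof (rule rho_minus_ge[OF Suc])
      show "rm n * N (Suc n) x \<le> M (N (Suc n)) x" for x
        unfolding mr_norm_Suc using n by (intro max_image_relax_ge c mr_le_max_image) auto
    qed
    moreover have "rp (Suc n) \<le> rp n"
      unfolding mr_rho_plus_def[of _ _ _ "Suc n"]
    proof (rule rho_plus_le[OF Suc])
      show "M (N (Suc n)) x \<le> rp n * N (Suc n) x" for x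
        unfolding mr_norm_Suc using n mr_minus_le_plus[OF n(1)]
        by (intro max_image_relax_le c max_image_le_mr) auto
    qed
    ultimately show ?thesis by blast
  qed
  show all: "is_norm (N n) \<and> 0 < rm n" for n
  proof (induction n)
    case 0
    show ?case using norm_0 rho_minus_0 by (simp add: mr_rho_minus_def)
  next
    case (Suc n)
    with step'[OF this] show ?case by linarith
  qed
  show "rm n \<le> rm (Suc n) \<and> rp (Suc n) \<le> rp n"
    using step'[OF all] by blast
qed

lemma norm_N: "is_norm (N n)" and rm_pos: "0 < rm n"
  using mr_norm_and_rho_pos by auto

lemma incseq_rm: "incseq rm" and decseq_rp: "decseq rp"
  using mr_rho_step by (auto intro: incseq_SucI decseq_SucI)

lemma rm_le_jsr: "rm n \<le> joint_spectral_radius \<A>" and jsr_le_rp: "joint_spectral_radius \<A> \<le> rp n"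
  using joint_spectral_radius_bounds[OF norm_N] by (simp_all add: mr_rho_minus_def mr_rho_plus_def)

lemma g_pos: "0 < g n"
  using averaging_function_between(1)[OF averaging rm_pos mr_minus_le_plus[OF norm_N], of n] rm_pos[of n]
  by linarith

text \<open>A bound with the same factor for all \<open>n\<close>, so that a single eccentricity
  constant serves all iterates.\<close>

lemma N_le_rp_0: "M (N n) x \<le> rp 0 * N n x"
proof -
  have "rp n \<le> rp 0" using decseq_rp by (simp add: decseqD)
  then have "rp n * N n x \<le> rp 0 * N n x"
    by (intro mult_right_mono is_seminorm_nonneg[OF is_norm_imp_is_seminorm[OF norm_N]])
  with max_image_le_mr[OF norm_N, of n x] show ?thesis by linarith
qed

text \<open>Relax \<open>p\<close> repeatedly with the limit factor \<open>G\<close>. The stage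
  \<open>S i\<close> is the limit of the iterates \<open>N (k j + i)\<close> divided by
  \<open>c j\<close>; as \<open>rm\<close> and \<open>rp\<close> converge along every shift, each
  \<open>S i\<close> has the extremal ratios \<open>a\<close> and \<open>b\<close>. By
  \<open>relaxation_not_stationary\<close> this is impossible for \<open>a < b\<close>, and with
  \<open>a = b\<close> the inequalities for \<open>p\<close> become an equality.\<close>

lemma mr_subsequence_limit:
  assumes k: "strict_mono (k :: nat \<Rightarrow> nat)" and c: "\<And>j. 0 < c j"
    and p: "is_norm p" and lim: "\<And>x. (\<lambda>j. N (k j) x / c j) \<longlonglongrightarrow> p x"
    and a: "rm \<longlonglongrightarrow> a" and b: "rp \<longlonglongrightarrow> b"
  shows "a = b" "barabanov_norm \<A> p"
proof -
  have rm_le_a: "rm n \<le> a" for n by (rule incseq_le[OF incseq_rm a])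
  have "0 < a" using rm_pos[of 0] rm_le_a[of 0] by linarith
  have "a \<le> b" by (rule LIMSEQ_le[OF a b]) (use mr_minus_le_plus[OF norm_N] in blast)
  define G where "G = \<gamma> a b"
  have "0 < G"
    using averaging_function_between(1)[OF averaging \<open>0 < a\<close> \<open>a \<le> b\<close>] \<open>0 < a\<close> by (simp add: G_def)
  have g_lim: "g \<longlonglongrightarrow> G"
    unfolding G_def
  proof (rule averaging_function_tendsto[OF averaging a b])
    show "0 < rp n" for n using rm_pos[of n] mr_minus_le_plus[OF norm_N, of n] by linarith
  qed (use \<open>0 < a\<close> \<open>a \<le> b\<close> rm_pos in auto)
  have shift: "filterlim (\<lambda>j. k j + i) sequentially sequentially" for i
    by (rule filterlim_subseq) (use k in \<open>simp add: strict_mono_def\<close>)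
  define S where "S = rec_nat p (\<lambda>_ N x. max (N x) (inverse G * M N x))"
  have S_0: "S 0 = p" and S_Suc: "S (Suc i) = (\<lambda>x. max (S i x) (inverse G * M (S i) x))" for i
    by (simp_all add: S_def)
  have norm_S: "is_norm (S i)" for i
    by (induction i) (use p \<open>0 < G\<close> in \<open>auto simp: S_0 S_Suc intro!: is_norm_relax\<close>)
  \<comment> \<open>The divisor \<open>c j\<close> is the same for all \<open>i\<close>, so by
    homogeneity the relaxation step from \<open>N (k j + i)\<close> to its successor carries over to
    \<open>H\<close>.\<close>
  define H where "H i j x = N (k j + i) x / c j" for i j x
  have norm_H: "is_norm (H i j)" for i j
    unfolding H_def by (rule is_norm_divide[OF norm_N c])
  have M_H: "M (H i j) x = M (N (k j + i)) x / c j" for i j x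
    unfolding H_def by (rule max_image_divide[OF c])
  have H_lim: "(\<lambda>j. H i j x) \<longlonglongrightarrow> S i x" for i x
  proof (induction i arbitrary: x)
    case 0
    show ?case using lim by (simp add: H_def S_0)
  next
    case (Suc i)
    have "H (Suc i) j x = max (H i j x) (inverse (g (k j + i)) * M (H i j) x)" for j
      unfolding M_H using c[of j] by (simp add: H_def mr_norm_Suc max_divide_distrib_right)
    moreover have "(\<lambda>j. max (H i j x) (inverse (g (k j + i)) * M (H i j) x))
        \<longlonglongrightarrow> max (S i x) (inverse G * M (S i) x)"
      using \<open>0 < G\<close>
      by (intro tendsto_max tendsto_mult tendsto_inverse Suc tendsto_max_image
          filterlim_compose[OF g_lim shift]) auto
    ultimately show ?case by (simp add: S_Suc)
  qed
  have M_H_lim: "(\<lambda>j. M (H i j) x) \<longlonglongrightarrow> M (S i) x" for i x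
    by (rule tendsto_max_image[OF H_lim])
  have a_shift: "(\<lambda>j. rm (k j + i)) \<longlonglongrightarrow> a" and b_shift: "(\<lambda>j. rp (k j + i)) \<longlonglongrightarrow> b" for i
    by (rule filterlim_compose[OF a shift] filterlim_compose[OF b shift])+
  have upper: "M (S i) x \<le> b * S i x" for i x
  proof (rule LIMSEQ_le[OF M_H_lim tendsto_mult[OF b_shift H_lim]])
    have "M (H i j) x \<le> rp (k j + i) * H i j x" for j
      unfolding M_H using divide_right_mono[OF max_image_le_mr[OF norm_N] less_imp_le[OF c]]
      by (simp add: H_def)
    then show "\<exists>n0. \<forall>j\<ge>n0. M (H i j) x \<le> rp (k j + i) * H i j x" by blast
  qed
  have lower: "a * S i x \<le> M (S i) x" for i x
  proof (rule LIMSEQ_le[OF tendsto_mult[OF a_shift H_lim] M_H_lim])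
    have "rm (k j + i) * H i j x \<le> M (H i j) x" for j
      unfolding M_H using divide_right_mono[OF mr_le_max_image[OF norm_N] less_imp_le[OF c]]
      by (simp add: H_def)
    then show "\<exists>n0. \<forall>j\<ge>n0. rm (k j + i) * H i j x \<le> M (H i j) x" by blast
  qed
  note sH = is_norm_imp_is_seminorm[OF norm_H]
  have a_attained: "\<exists>x. norm x = 1 \<and> M (S i) x = a * S i x" for i
  proof -
    have "\<forall>j. \<exists>x. norm x = 1 \<and> M (N (k j + i)) x = rm (k j + i) * N (k j + i) x"
      unfolding mr_rho_minus_def by (intro allI rho_minus_attained norm_N)
    then obtain z where z: "\<And>j. norm (z j) = 1"
      "\<And>j. M (N (k j + i)) (z j) = rm (k j + i) * N (k j + i) (z j)"
      by metis
    have "M (H i j) (z j) = rm (k j + i) * H i j (z j)" for j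
      unfolding M_H z(2) by (simp add: H_def)
    from max_image_eq_LIMSEQ[of "H i" "S i", OF sH H_lim z(1) this a_shift] show ?thesis by blast
  qed
  have b_attained: "\<exists>x. norm x = 1 \<and> M (S i) x = b * S i x" for i
  proof -
    have "\<forall>j. \<exists>x. norm x = 1 \<and> M (N (k j + i)) x = rp (k j + i) * N (k j + i) x"
      unfolding mr_rho_plus_def by (intro allI rho_plus_attained norm_N)
    then obtain z where z: "\<And>j. norm (z j) = 1"
      "\<And>j. M (N (k j + i)) (z j) = rp (k j + i) * N (k j + i) (z j)"
      by metis
    have "M (H i j) (z j) = rp (k j + i) * H i j (z j)" for j
      unfolding M_H z(2) by (simp add: H_def)
    from max_image_eq_LIMSEQ[of "H i" "S i", OF sH H_lim z(1) this b_shift] show ?thesis by blast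
  qed
  show "a = b"
  proof (rule ccontr)
    assume "a \<noteq> b"
    with \<open>a \<le> b\<close> have "a < b" by simp
    have "a < G" "G < b"
      unfolding G_def
      using averaging_function_between(3,4)[OF averaging \<open>0 < a\<close> \<open>a \<le> b\<close> \<open>a < b\<close>] by auto
    from relaxation_not_stationary[of S G a b, OF norm_S _ \<open>0 < G\<close> this upper a_attained b_attained]
    show False by (simp add: S_Suc)
  qed
  moreover have "joint_spectral_radius \<A> = b"
  proof (rule antisym)
    show "joint_spectral_radius \<A> \<le> b"
      by (rule LIMSEQ_le_const[OF b]) (use jsr_le_rp in blast)
    have "a \<le> joint_spectral_radius \<A>"
      by (rule LIMSEQ_le_const2[OF a]) (use rm_le_jsr in blast)
    then show "b \<le> joint_spectral_radius \<A>" using \<open>a = b\<close> by simp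
  qed
  ultimately show "barabanov_norm \<A> p"
    using p upper[of 0] lower[of 0] by (auto simp: barabanov_norm_def S_0 intro: antisym)
qed

text \<open>One iterate that is close to \<open>p\<close> up to a positive factor has eccentricity
  near 1 with respect to \<open>p\<close>. By \<open>relax_eccentricity\<close> all later iterates
  keep this bound, and normalization at \<open>e\<close> turns it into closeness to
  \<open>p\<close>.\<close>

lemma barabanov_limit_uniform:
  assumes p: "barabanov_norm \<A> p" and "p e = 1" and "0 < joint_spectral_radius \<A>"
    and near: "\<And>\<epsilon>. 0 < \<epsilon> \<Longrightarrow> \<exists>n d. 0 < d \<and> (\<forall>x. \<bar>N n x / d - p x\<bar> \<le> \<epsilon> * norm x)"
    and "bounded B"
  shows "uniform_limit B (mr_norm_normalized \<A> \<gamma> N\<^sub>0 e) p sequentially"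
proof (rule uniform_limitI)
  fix \<epsilon> :: real assume "0 < \<epsilon>"
  have pn: "is_norm p" and eq: "\<And>x. M p x = joint_spectral_radius \<A> * p x"
    using p by (auto simp: barabanov_norm_def)
  have p0: "0 \<le> p x" for x by (rule is_seminorm_nonneg[OF is_norm_imp_is_seminorm[OF pn]])
  obtain D where D: "\<And>x. x \<in> B \<Longrightarrow> p x \<le> D" "0 < D"
  proof -
    obtain K where K: "\<And>x. x \<in> B \<Longrightarrow> norm x \<le> K" "0 < K"
      using \<open>bounded B\<close> bounded_pos by metis
    obtain C where C: "C > 0" "\<And>x. p x \<le> C * norm x"
      using is_seminorm_bounded[OF is_norm_imp_is_seminorm[OF pn]] by blast
    show thesis
    proof (rule that)
      show "p x \<le> C * K" if "x \<in> B" for x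
        using C(2)[of x] mult_left_mono[OF K(1)[OF that], of C] C(1) by linarith
    qed (use C K in simp)
  qed
  \<comment> \<open>The target eccentricity; \<open>D + 1\<close> instead of \<open>D\<close> makes
    \<open>(q - 1) * D\<close> strictly smaller than \<epsilon>.\<close>
  define q where "q = 1 + \<epsilon> / (D + 1)"
  have q: "1 < q" using \<open>0 < \<epsilon>\<close> D(2) by (simp add: q_def)
  have qD: "(q - 1) * D < \<epsilon>" using \<open>0 < \<epsilon>\<close> D(2) by (simp add: q_def field_simps)
  \<comment> \<open>The solution of \<open>(1 + \<delta>) / (1 - \<delta>) = q\<close>: a relative
    error \<delta> in both arguments gives eccentricity at most \<open>q\<close>.\<close>
  define \<delta> where "\<delta> = (q - 1) / (q + 1)"
  have \<delta>: "0 < \<delta>" "1 + \<delta> = q * (1 - \<delta>)" using q by (simp_all add: \<delta>_def field_simps)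
  obtain c where c: "c > 0" "\<And>x. c * norm x \<le> p x"
    using is_norm_lower_bound[OF pn] by blast
  \<comment> \<open>The factor \<open>c\<close> converts an error relative to \<open>norm x\<close>
    into one relative to \<open>p x\<close>.\<close>
  obtain m d where d: "0 < d" "\<And>x. \<bar>N m x / d - p x\<bar> \<le> (\<delta> * c) * norm x"
    using near[of "\<delta> * c"] \<delta>(1) c(1) by (metis mult_pos_pos)
  have d': "\<bar>N m x / d - p x\<bar> \<le> \<delta> * p x" for x
    by (rule order_trans[OF d(2)])
      (use mult_left_mono[OF c(2) less_imp_le[OF \<delta>(1)]] in \<open>simp add: mult.assoc\<close>)
  have start: "N m x * p y \<le> q * (N m y * p x)" for x y
  proof -
    have "N m x / d * p y \<le> ((1 + \<delta>) * p x) * p y"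
      using d'[of x] by (intro mult_right_mono p0) (simp add: distrib_right)
    also have "\<dots> = q * p x * ((1 - \<delta>) * p y)" by (simp add: \<delta>(2))
    also have "\<dots> \<le> q * p x * (N m y / d)"
      using d'[of y] q by (intro mult_left_mono) (simp_all add: left_diff_distrib p0)
    finally show ?thesis using d(1) by (simp add: field_simps)
  qed
  have ecc: "N n x * p y \<le> q * (N n y * p x)" if "m \<le> n" for n x y
    using that
  proof (induction n arbitrary: x y rule: dec_induct)
    case base
    show ?case by (rule start)
  next
    case (step n)
    show ?case
      unfolding mr_norm_Suc
      by (rule relax_eccentricity[OF norm_N pn eq])
        (use step.IH q g_pos[of n] \<open>0 < joint_spectral_radius \<A>\<close> in auto)
  qed
  show "\<forall>\<^sub>F n in sequentially. \<forall>x\<in>B. dist (mr_norm_normalized \<A> \<gamma> N\<^sub>0 e n x) (p x) < \<epsilon>"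
  proof (rule eventually_sequentiallyI[of m], rule ballI)
    fix n x assume "m \<le> n" "x \<in> B"
    have "e \<noteq> 0" using \<open>p e = 1\<close> is_seminorm_zero[OF is_norm_imp_is_seminorm[OF pn]] by auto
    then have pos: "0 < N n e" by (rule is_norm_pos[OF norm_N])
    define f where "f = N n x / N n e"
    \<comment> \<open>The eccentricity bound is used in both orders for the pair \<open>x\<close>,
      \<open>e\<close>, with \<open>p e = 1\<close>.\<close>
    have up: "f \<le> q * p x" and low: "p x \<le> q * f"
      using ecc[OF \<open>m \<le> n\<close>, of x e] ecc[OF \<open>m \<le> n\<close>, of e x] pos \<open>p e = 1\<close>
      by (simp_all add: f_def field_simps)
    have "f - p x \<le> (q - 1) * p x" using up by (simp add: left_diff_distrib)
    moreover have "p x - f \<le> (q - 1) * p x"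
    proof -
      \<comment> \<open>This says \<open>(q - 1) * p x \<le> q * ((q - 1) * p x)\<close>, after
        which \<open>q\<close> can be cancelled.\<close>
      have "0 \<le> (q - 1) * (q - 1) * p x" using p0 by simp
      moreover have "q * (p x - f) \<le> (q - 1) * p x" using low by (simp add: algebra_simps)
      ultimately have "q * (p x - f) \<le> q * ((q - 1) * p x)" by (simp add: algebra_simps)
      then show ?thesis using q by simp
    qed
    ultimately have "\<bar>f - p x\<bar> \<le> (q - 1) * p x" by linarith
    also have "\<dots> \<le> (q - 1) * D" using q D(1)[OF \<open>x \<in> B\<close>] by (intro mult_left_mono) auto
    finally show "dist (mr_norm_normalized \<A> \<gamma> N\<^sub>0 e n x) (p x) < \<epsilon>"
      using qD by (simp add: mr_norm_normalized_def dist_real_def f_def)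
  qed
qed

text \<open>Bounded eccentricity gives a convergent subsequence of the normalized iterates, and
  \<open>mr_subsequence_limit\<close> identifies its limit as a Barabanov norm. Closeness along the
  subsequence suffices for the whole sequence by \<open>barabanov_limit_uniform\<close>.\<close>

lemma mr_convergence:
  assumes "e \<noteq> 0"
  shows "rp \<longlonglongrightarrow> joint_spectral_radius \<A>" "rm \<longlonglongrightarrow> joint_spectral_radius \<A>"
    "\<exists>p. barabanov_norm \<A> p \<and>
       (\<forall>B. bounded B \<longrightarrow> uniform_limit B (mr_norm_normalized \<A> \<gamma> N\<^sub>0 e) p sequentially)"
proof -
  obtain a where a: "rm \<longlonglongrightarrow> a"
    by (rule incseq_convergent[OF incseq_rm, of "joint_spectral_radius \<A>"]) (use rm_le_jsr in blast)+
  obtain b where b: "rp \<longlonglongrightarrow> b"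
    by (rule decseq_convergent[OF decseq_rp, of "joint_spectral_radius \<A>"]) (use jsr_le_rp in blast)+
  obtain C where C: "C > 0"
    "\<And>N x y. is_norm N \<Longrightarrow> (\<And>z. M N z \<le> rp 0 * N z) \<Longrightarrow> N y * norm x \<le> C * (N x * norm y)"
    using bounded_eccentricity_homogeneous[of "rp 0"] by blast
  note ecc = C(2)[OF norm_N N_le_rp_0]
  have e: "0 < N n e" for n by (rule is_norm_pos[OF norm_N \<open>e \<noteq> 0\<close>])
  define F where "F n x = N n x / N n e" for n x
  have F: "is_norm (F n)" for n unfolding F_def by (rule is_norm_divide[OF norm_N e])
  have F_le: "F n x \<le> (C / norm e) * norm x" for n x
    using ecc[of n x e] e[of n] \<open>e \<noteq> 0\<close> by (simp add: F_def field_simps)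
  \<comment> \<open>The lower bound passes to the limit and keeps it definite.\<close>
  have F_ge: "1 / (C * norm e) * norm x \<le> F n x" for n x
    using ecc[of n e x] e[of n] \<open>e \<noteq> 0\<close> C(1) by (simp add: F_def field_simps)
  obtain k p where k: "strict_mono (k :: nat \<Rightarrow> nat)" and p: "is_seminorm p"
    and lim: "\<And>x. (\<lambda>j. F (k j) x) \<longlonglongrightarrow> p x"
    and unif: "\<And>\<epsilon>. 0 < \<epsilon> \<Longrightarrow> \<forall>\<^sub>F j in sequentially. \<forall>x. \<bar>F (k j) x - p x\<bar> \<le> \<epsilon> * norm x"
    by (rule is_seminorm_convergent_subsequence[of F "C / norm e", OF is_norm_imp_is_seminorm[OF F] F_le])
      (rule that)
  have "is_norm p"
  proof (rule is_normI[OF p])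
    fix x :: "real^'m" assume "x \<noteq> 0"
    then have "0 < 1 / (C * norm e) * norm x" using C(1) \<open>e \<noteq> 0\<close> by simp
    also have "\<dots> \<le> p x" by (rule LIMSEQ_le_const[OF lim]) (use F_ge in blast)
    finally show "0 < p x" .
  qed
  have lim': "(\<lambda>j. N (k j) x / N (k j) e) \<longlonglongrightarrow> p x" for x
    using lim[of x] by (simp add: F_def)
  have ab: "a = b" and bara: "barabanov_norm \<A> p"
    using mr_subsequence_limit[of k "\<lambda>j. N (k j) e", OF k e \<open>is_norm p\<close> lim' a b] by auto
  have "a \<le> joint_spectral_radius \<A>"
    by (rule LIMSEQ_le_const2[OF a]) (use rm_le_jsr in blast)
  moreover have "joint_spectral_radius \<A> \<le> b"
    by (rule LIMSEQ_le_const[OF b]) (use jsr_le_rp in blast)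
  ultimately show "rp \<longlonglongrightarrow> joint_spectral_radius \<A>" "rm \<longlonglongrightarrow> joint_spectral_radius \<A>"
    using a b ab by auto
  have "p e = 1"
    using lim'[of e] e by (simp add: LIMSEQ_const_iff less_imp_neq[symmetric])
  have jsr: "0 < joint_spectral_radius \<A>" using rm_pos[of 0] rm_le_jsr[of 0] by linarith
  have "uniform_limit B (mr_norm_normalized \<A> \<gamma> N\<^sub>0 e) p sequentially" if "bounded B" for B
  proof (rule barabanov_limit_uniform[OF bara \<open>p e = 1\<close> jsr _ that])
    fix \<epsilon> :: real assume "0 < \<epsilon>"
    from unif[OF this] obtain j where "\<forall>x. \<bar>F (k j) x - p x\<bar> \<le> \<epsilon> * norm x"
      by (auto simp: eventually_sequentially)
    then show "\<exists>n d. 0 < d \<and> (\<forall>x. \<bar>N n x / d - p x\<bar> \<le> \<epsilon> * norm x)"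
      using e by (auto simp: F_def)
  qed
  with bara show "\<exists>p. barabanov_norm \<A> p \<and>
       (\<forall>B. bounded B \<longrightarrow> uniform_limit B (mr_norm_normalized \<A> \<gamma> N\<^sub>0 e) p sequentially)"
    by blast
qed

end

theorem mainTheorem1:
  fixes \<A> :: "(real^'m^'m) set"
    and e :: "real^'m"
    and N\<^sub>0 :: "real^'m \<Rightarrow> real"
    and \<gamma> :: "real \<Rightarrow> real \<Rightarrow> real"
  assumes "finite \<A>" and "\<A> \<noteq> {}"
    and "irreducible_set \<A>"
    and "e \<noteq> 0"
    and "is_norm N\<^sub>0"
    and "averaging_function \<gamma>"
  shows "mr_rho_plus \<A> \<gamma> N\<^sub>0 \<longlonglongrightarrow> joint_spectral_radius \<A> \<and>
         mr_rho_minus \<A> \<gamma> N\<^sub>0 \<longlonglongrightarrow> joint_spectral_radius \<A> \<and>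
         (\<exists>N. barabanov_norm \<A> N \<and>
            (\<forall>B. bounded B \<longrightarrow>
               uniform_limit B (mr_norm_normalized \<A> \<gamma> N\<^sub>0 e) N sequentially)) \<and>
         incseq (mr_rho_minus \<A> \<gamma> N\<^sub>0) \<and>
         decseq (mr_rho_plus \<A> \<gamma> N\<^sub>0) \<and>
         (\<forall>n\<ge>1. mr_rho_minus \<A> \<gamma> N\<^sub>0 n \<le> joint_spectral_radius \<A> \<and>
                 joint_spectral_radius \<A> \<le> mr_rho_plus \<A> \<gamma> N\<^sub>0 n)"
proof -
  interpret irreducible_matrix_set \<A>
    using assms by unfold_locales auto
  note N = \<open>is_norm N\<^sub>0\<close>
  show ?thesis
  proof (cases "rho_minus \<A> N\<^sub>0 = 0")
    \<comment> \<open>Here \<open>M\<close> sends the initial norm to 0, so relaxation leaves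
      \<open>N\<^sub>0\<close> unchanged whatever value \<open>\<gamma> 0 0\<close> has, and all
      sequences are constant.\<close>
    case True
    note M_0 = max_image_eq_zero[OF N True]
    have rp_0: "rho_plus \<A> N\<^sub>0 = 0"
      using rho_plus_le[OF N, of 0] rho_minus_le_rho_plus[OF N] True M_0 by auto
    have stationary: "mr_norm \<A> \<gamma> N\<^sub>0 n = N\<^sub>0" for n
      by (induction n)
        (simp_all add: M_0 Let_def max_absorb1 is_seminorm_nonneg[OF is_norm_imp_is_seminorm[OF N]])
    have rates: "mr_rho_plus \<A> \<gamma> N\<^sub>0 = (\<lambda>_. 0)" "mr_rho_minus \<A> \<gamma> N\<^sub>0 = (\<lambda>_. 0)"
      by (simp_all add: fun_eq_iff mr_rho_plus_def mr_rho_minus_def stationary rp_0 True)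
    have jsr: "joint_spectral_radius \<A> = 0"
      using joint_spectral_radius_bounds[OF N] rp_0 True by simp
    have e: "0 < N\<^sub>0 e" by (rule is_norm_pos[OF N \<open>e \<noteq> 0\<close>])
    have "barabanov_norm \<A> (\<lambda>x. N\<^sub>0 x / N\<^sub>0 e)"
      unfolding barabanov_norm_def jsr using is_norm_divide[OF N e] by (simp add: max_image_divide[OF e] M_0)
    moreover have "mr_norm_normalized \<A> \<gamma> N\<^sub>0 e = (\<lambda>n x. N\<^sub>0 x / N\<^sub>0 e)"
      by (simp add: fun_eq_iff mr_norm_normalized_def stationary)
    ultimately show ?thesis
      unfolding rates jsr by (auto intro!: exI[of _ "\<lambda>x. N\<^sub>0 x / N\<^sub>0 e"] incseq_const decseq_const
          uniform_limit_const)
  next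
    case False
    then interpret max_relaxation \<A> \<gamma> N\<^sub>0
      using assms rho_minus_nonneg[OF N] by unfold_locales auto
    show ?thesis
      using mr_convergence[OF \<open>e \<noteq> 0\<close>] incseq_rm decseq_rp rm_le_jsr jsr_le_rp by blast
  qed
qed

end
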